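(* Let $(X,\mathfrak A,P)$ and $(Y,\mathfrak B,Q)$ be probability spaces such that $(Y,\mathfrak B,Q)$ admits a lifting, let $R$ be a probability measure on $\mathfrak A\otimes\mathfrak B$ with marginals $P$ and $Q$, and let $\{S_y:y\in Y\}$ be a product regular conditional probability on $\mathfrak A$ for $R$ with respect to $Q$. Assume that $\mathfrak A$ contains a countable algebra which is dense in $\mathfrak A$ with respect to $P$. Then for each bounded $\widehat R$-measurable real-valued stochastic process $\{\xi_y\}_{y\in Y}$ on $(X,\mathfrak A,P)$ there are a collection $\widetilde\zeta:=\{\zeta_y\}_{y\in Y}$ of $\widehat S_y$-measurable functions $\zeta_y$ on $X$ and a collection of liftings $\sigma_y\in\Lambda(\widehat S_y)$, $y\in Y$, such that: (i) $\xi_y=\zeta_y$ a.e. $(S_y)$ for all $y\in Y$; (ii) $\zeta_y=\sigma_y(\zeta_y)$ for all $y\in Y$; (iii) the map $\widetilde\zeta:X\times Y\to(-\infty,+\infty)$, $(x,y)\mapsto\zeta_y(x)$, is $\widehat R$-measurable.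
   Context: For a probability space $(Z,\mathfrak Z,S)$, $(Z,\widehat{\mathfrak Z},\widehat S)$ denotes its completion. A lower density on $(Z,\mathfrak Z,S)$ is a map $\delta:\mathfrak Z\to\mathfrak Z$ such that $\delta(A)=A$ a.e. $(S)$; $A=B$ a.e. implies $\delta(A)=\delta(B)$; $\delta(\varnothing)=\varnothing$, $\delta(Z)=Z$; $\delta(A\cap B)=\delta(A)\cap\delta(B)$. A lifting is a lower density with in addition $\delta(A^c)=\delta(A)^c$. $\Lambda(S)$ is the set of all liftings on $(Z,\mathfrak Z,S)$. Each lifting $\delta$ on $\mathfrak Z$ corresponds to a unique lifting on the (essentially) bounded $\mathfrak Z$-measurable real functions (a positive, linear, multiplicative map, preserving constants, choosing one bounded representative from each a.e.-equivalence class), denoted by the same letter, with $\delta(\chi_A)=\chi_{\delta(A)}$. $\mathfrak A\otimes\mathfrak B$ is the product $\sigma$-algebra; $(X\times Y,\mathfrak A\widehat\otimes_R\mathfrak B,\widehat R)$ is the completion of $(X\times Y,\mathfrak A\otimes\mathfrak B,R)$. A product regular conditional probability on $\mathfrak A$ for $R$ with respect to $Q$ is a family $\{S_y:y\in Y\}$ of probability measures on $\mathfrak A$ such that $y\mapsto S_y(A)$ is $\mathfrak B$-measurable for each $A\in\mathfrak A$, and $R(A\times B)=\int_B S_y(A)\,dQ(y)$ for all $A\in\mathfrak A$, $B\in\mathfrak B$. $(X,\widehat{\mathfrak A}_y,\widehat S_y)$ is the completion of $(X,\mathfrak A,S_y)$. Density of a family in $\mathfrak A$ with respect to $P$ means density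 for the pseudometric $d(A,A')=P(A\triangle A')$. A real-valued stochastic process on $(X,\mathfrak A,P)$ indexed by $Y$ is a family $\{\xi_y\}_{y\in Y}$ of $\mathfrak A$-measurable functions $\xi_y:X\to\mathbb R$. It is $\widehat R$-measurable if $(x,y)\mapsto\xi_y(x)$ is $\widehat R$-measurable, and bounded if $\sup_{y\in Y}\|\xi_y\|_{\mathcal L^\infty(S_y)}<\infty$, where $\|\cdot\|_{\mathcal L^\infty(S_y)}$ is the $S_y$-essential supremum norm. *)

theory Defs
  imports "HOL-Probability.Probability"
begin

definition lower_density :: "'z measure \<Rightarrow> ('z set \<Rightarrow> 'z set) \<Rightarrow> bool" where
  "lower_density M \<delta> \<longleftrightarrow>
     (\<forall>A\<in>sets M. \<delta> A \<in> sets M) \<and>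
     (\<forall>A\<in>sets M. AE x in M. x \<in> \<delta> A \<longleftrightarrow> x \<in> A) \<and>
     (\<forall>A\<in>sets M. \<forall>B\<in>sets M. (AE x in M. x \<in> A \<longleftrightarrow> x \<in> B) \<longrightarrow> \<delta> A = \<delta> B) \<and>
     \<delta> {} = {} \<and> \<delta> (space M) = space M \<and>
     (\<forall>A\<in>sets M. \<forall>B\<in>sets M. \<delta> (A \<inter> B) = \<delta> A \<inter> \<delta> B)"

text \<open>The set \<open>\<Lambda>(M)\<close> of all liftings. A map \<open>\<delta>\<close> is constrained only by its values on
  \<^term>\<open>sets M\<close>.\<close>

definition liftings :: "'z measure \<Rightarrow> ('z set \<Rightarrow> 'z set) set" where
  "liftings M =
     {\<delta>. lower_density M \<delta> \<and> (\<forall>A\<in>sets M. \<delta> (space M - A) = space M - \<delta> A)}"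

definition Linf_norm :: "'z measure \<Rightarrow> ('z \<Rightarrow> real) \<Rightarrow> ereal" where
  "Linf_norm M f = esssup M (\<lambda>x. ereal \<bar>f x\<bar>)"

definition ess_bounded :: "'z measure \<Rightarrow> ('z \<Rightarrow> real) set" where
  "ess_bounded M = {f \<in> borel_measurable M. Linf_norm M f < \<infinity>}"

text \<open>Liftings of functions. Only the values on \<^term>\<open>space M\<close> of the images of functions in
  \<^term>\<open>ess_bounded M\<close> are constrained.\<close>

definition function_lifting ::
    "'z measure \<Rightarrow> (('z \<Rightarrow> real) \<Rightarrow> ('z \<Rightarrow> real)) \<Rightarrow> bool" where
  "function_lifting M L \<longleftrightarrow>
     (\<forall>f\<in>ess_bounded M. L f \<in> borel_measurable M \<and> (\<exists>c. \<forall>x\<in>space M. \<bar>L f x\<bar> \<le> c) \<and>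
        (AE x in M. L f x = f x)) \<and>
     (\<forall>f\<in>ess_bounded M. \<forall>g\<in>ess_bounded M.
        (AE x in M. f x = g x) \<longrightarrow> (\<forall>x\<in>space M. L f x = L g x)) \<and>
     (\<forall>f\<in>ess_bounded M. (\<forall>x\<in>space M. 0 \<le> f x) \<longrightarrow> (\<forall>x\<in>space M. 0 \<le> L f x)) \<and>
     (\<forall>f\<in>ess_bounded M. \<forall>g\<in>ess_bounded M. \<forall>a b. \<forall>x\<in>space M.
        L (\<lambda>z. a * f z + b * g z) x = a * L f x + b * L g x) \<and>
     (\<forall>f\<in>ess_bounded M. \<forall>g\<in>ess_bounded M. \<forall>x\<in>space M.
        L (\<lambda>z. f z * g z) x = L f x * L g x) \<and>
     (\<forall>c. \<forall>x\<in>space M. L (\<lambda>_. c) x = c)"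

text \<open>For a lifting \<open>\<delta>\<close>, the values on \<^term>\<open>space M\<close> of \<open>L f\<close>, for \<open>f\<close> in
  \<^term>\<open>ess_bounded M\<close>, are uniquely determined by this relation; \<open>L\<close> is the function lifting
  that is customarily denoted by the same letter as \<open>\<delta>\<close>.\<close>

definition induces_function_lifting ::
    "'z measure \<Rightarrow> ('z set \<Rightarrow> 'z set) \<Rightarrow> (('z \<Rightarrow> real) \<Rightarrow> ('z \<Rightarrow> real)) \<Rightarrow> bool" where
  "induces_function_lifting M \<delta> L \<longleftrightarrow>
     function_lifting M L \<and>
     (\<forall>A\<in>sets M. \<forall>x\<in>space M. L (indicator A) x = indicator (\<delta> A) x)"

definition product_rcp ::
    "'a measure \<Rightarrow> 'b measure \<Rightarrow> ('a \<times> 'b) measure \<Rightarrow> ('b \<Rightarrow> 'a measure) \<Rightarrow> bool" where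
  "product_rcp P Q R S \<longleftrightarrow>
     (\<forall>y\<in>space Q. prob_space (S y) \<and> sets (S y) = sets P) \<and>
     (\<forall>A\<in>sets P. (\<lambda>y. emeasure (S y) A) \<in> borel_measurable Q) \<and>
     (\<forall>A\<in>sets P. \<forall>B\<in>sets Q. emeasure R (A \<times> B) = (\<integral>\<^sup>+y\<in>B. emeasure (S y) A \<partial>Q))"

definition dense_family :: "'a measure \<Rightarrow> 'a set set \<Rightarrow> bool" where
  "dense_family P G \<longleftrightarrow>
     G \<subseteq> sets P \<and> (\<forall>A\<in>sets P. \<forall>e>0. \<exists>B\<in>G. measure P (sym_diff A B) < e)"

definition real_process :: "'a measure \<Rightarrow> 'b set \<Rightarrow> ('b \<Rightarrow> 'a \<Rightarrow> real) \<Rightarrow> bool" where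
  "real_process P I \<xi> \<longleftrightarrow> (\<forall>y\<in>I. \<xi> y \<in> borel_measurable P)"

definition jointly_measurable :: "('a \<times> 'b) measure \<Rightarrow> ('b \<Rightarrow> 'a \<Rightarrow> real) \<Rightarrow> bool" where
  "jointly_measurable N \<xi> \<longleftrightarrow> (\<lambda>(x, y). \<xi> y x) \<in> borel_measurable N"

definition bounded_process ::
    "('b \<Rightarrow> 'a measure) \<Rightarrow> 'b set \<Rightarrow> ('b \<Rightarrow> 'a \<Rightarrow> real) \<Rightarrow> bool" where
  "bounded_process S I \<xi> \<longleftrightarrow> (SUP y\<in>I. Linf_norm (S y) (\<xi> y)) < \<infinity>"

end

theory Submission
  imports Defs
begin

text \<open>On a complete probability space, a bounded measurable function \<open>f\<close> is fixed by some lifting as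
  soon as every value of \<open>f\<close> belongs to the essential range of \<open>f\<close>. Indeed, a lifting is a choice, for
  every point \<open>x\<close>, of an ultrafilter of measurable sets without null sets, and it may be changed on a
  null set of points. Any lifting fixes \<open>f\<close> off a null set, and for \<open>x\<close> in that set one may take an
  ultrafilter containing all the sets \<open>{z. \<bar>f z - f x\<bar> < e}\<close>, as these have positive measure. So it
  suffices to let \<open>\<zeta>\<^sub>y\<close> be \<open>\<xi>\<^sub>y\<close> with the values outside its essential range replaced by one value
  inside. The replaced points \<open>(x, y)\<close> lie, for some rational interval \<open>I\<close>, in
  \<open>{(x, y). \<xi>\<^sub>y(x) \<in> I \<and> S\<^sub>y(\<xi>\<^sub>y \<in> I) = 0}\<close>, and these countably many sets are \<open>R\<close>-null by
  disintegration, whence the joint measurability of \<open>\<zeta>\<close>.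

  The measures \<open>S\<^sub>y\<close> are arbitrary for \<open>y\<close> in a null set, so the existence of liftings (the von
  Neumann-Maharam theorem) is needed in full. It follows by Zorn's lemma: liftings on
  sub-\<open>\<sigma>\<close>-algebras extend by one set, and along increasing sequences by the martingale convergence
  theorem for conditional probabilities.\<close>

section \<open>Ultrafilters of measurable sets\<close>

text \<open>An ultrafilter of the measure algebra, the Boolean algebra \<open>sets M\<close> modulo
  null sets, presented through representatives. Upward closure and invariance under a.e. equality
  are derived in \<open>ae_ultrafilter_mono\<close> and \<open>ae_ultrafilter_cong\<close>.\<close>

definition ae_ultrafilter :: "'a measure \<Rightarrow> 'a set set \<Rightarrow> bool" where
  "ae_ultrafilter M U \<longleftrightarrow>
     U \<subseteq> sets M \<and> (\<forall>A\<in>sets M. space M - A \<in> U \<longleftrightarrow> A \<notin> U) \<and>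
     (\<forall>A\<in>U. \<forall>B\<in>U. A \<inter> B \<in> U) \<and> (\<forall>A\<in>U. \<not> (AE x in M. x \<notin> A))"

lemma ae_ultrafilterD:
  assumes "ae_ultrafilter M U"
  shows ae_ultrafilter_sets: "A \<in> U \<Longrightarrow> A \<in> sets M"
    and ae_ultrafilter_compl: "A \<in> sets M \<Longrightarrow> space M - A \<in> U \<longleftrightarrow> A \<notin> U"
    and ae_ultrafilter_Int: "A \<in> U \<Longrightarrow> B \<in> U \<Longrightarrow> A \<inter> B \<in> U"
    and ae_ultrafilter_not_null: "A \<in> U \<Longrightarrow> \<not> (AE x in M. x \<notin> A)"
  using assms unfolding ae_ultrafilter_def by blast+

text \<open>If \<open>B\<close> were missing, its complement would be a member, and the intersection
  of that complement with \<open>A\<close> would be a null member.\<close>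

lemma ae_ultrafilter_mono:
  assumes U: "ae_ultrafilter M U" and A: "A \<in> U" and B: "B \<in> sets M"
    and AB: "AE x in M. x \<in> A \<longrightarrow> x \<in> B"
  shows "B \<in> U"
proof (rule ccontr)
  assume "B \<notin> U"
  then have "A \<inter> (space M - B) \<in> U"
    using U A B by (simp add: ae_ultrafilter_Int ae_ultrafilter_compl)
  moreover have "AE x in M. x \<notin> A \<inter> (space M - B)"
    using AB by eventually_elim auto
  ultimately show False
    using ae_ultrafilter_not_null[OF U] by blast
qed

lemma ae_ultrafilter_cong:
  assumes "ae_ultrafilter M U" "A \<in> sets M" "B \<in> sets M" "AE x in M. x \<in> A \<longleftrightarrow> x \<in> B"
  shows "A \<in> U \<longleftrightarrow> B \<in> U"
proof -
  have "AE x in M. x \<in> A \<longrightarrow> x \<in> B" "AE x in M. x \<in> B \<longrightarrow> x \<in> A"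
    using assms(4) by (eventually_elim, blast)+
  then show ?thesis
    using ae_ultrafilter_mono[OF assms(1)] assms(2,3) by blast
qed

lemma ae_ultrafilter_Int_iff:
  assumes U: "ae_ultrafilter M U" and "A \<in> sets M" "B \<in> sets M"
  shows "A \<inter> B \<in> U \<longleftrightarrow> A \<in> U \<and> B \<in> U"
proof
  assume "A \<inter> B \<in> U"
  from ae_ultrafilter_mono[OF U this] assms(2,3) show "A \<in> U \<and> B \<in> U" by simp
qed (simp add: ae_ultrafilter_Int[OF U])

lemma ae_ultrafilter_empty: "ae_ultrafilter M U \<Longrightarrow> {} \<notin> U"
  by (auto dest: ae_ultrafilter_not_null)

lemma ae_ultrafilter_space: "ae_ultrafilter M U \<Longrightarrow> space M \<in> U"
  using ae_ultrafilter_compl[of M U "{}"] ae_ultrafilter_empty[of M U] by simp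

lemma ae_ultrafilter_AE:
  "ae_ultrafilter M U \<Longrightarrow> A \<in> sets M \<Longrightarrow> AE x in M. x \<in> A \<Longrightarrow> A \<in> U"
  by (rule ae_ultrafilter_mono[of M U "space M"]) (auto simp: ae_ultrafilter_space)

text \<open>Zorn's lemma gives a maximal family \<open>H\<close> of non-null measurable sets that
  contains \<B> and is closed under intersection. If \<open>A \<notin> H\<close>, maximality yields
  \<open>B \<in> H\<close> with \<open>B \<inter> A\<close> null; then the complement of
  \<open>A\<close> meets every member of \<open>H\<close> in a non-null set and so belongs to
  \<open>H\<close>.\<close>

lemma ae_ultrafilter_exists:
  assumes "\<B> \<subseteq> sets M" "\<B> \<noteq> {}" "\<And>A B. A \<in> \<B> \<Longrightarrow> B \<in> \<B> \<Longrightarrow> A \<inter> B \<in> \<B>"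
    and "\<And>A. A \<in> \<B> \<Longrightarrow> \<not> (AE x in M. x \<notin> A)"
  obtains U where "ae_ultrafilter M U" "\<B> \<subseteq> U"
proof -
  define F where "F = {H. \<B> \<subseteq> H \<and> H \<subseteq> sets M \<and> (\<forall>A\<in>H. \<forall>B\<in>H. A \<inter> B \<in> H) \<and>
     (\<forall>A\<in>H. \<not> (AE x in M. x \<notin> A))}"
  have "\<exists>H\<in>F. \<forall>X\<in>F. H \<subseteq> X \<longrightarrow> X = H"
  proof (rule subset_Zorn_nonempty)
    show "F \<noteq> {}" using assms by (auto simp: F_def)
    fix C assume C: "C \<noteq> {}" "subset.chain F C"
    have CF: "X \<in> F" if "X \<in> C" for X
      using C that by (auto simp: subset_chain_def)
    show "\<Union>C \<in> F"
      unfolding F_def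
    proof (intro CollectI conjI ballI)
      show "\<B> \<subseteq> \<Union>C" "\<Union>C \<subseteq> sets M"
        using C(1) CF unfolding F_def by blast+
      fix A assume A: "A \<in> \<Union>C"
      show "\<not> (AE x in M. x \<notin> A)"
        using CF A unfolding F_def by blast
      fix B assume B: "B \<in> \<Union>C"
      from A B obtain X Y where XY: "X \<in> C" "Y \<in> C" "A \<in> X" "B \<in> Y" by auto
      then have "X \<subseteq> Y \<or> Y \<subseteq> X" using C by (auto simp: subset_chain_def)
      then obtain Z where "Z \<in> C" "A \<in> Z" "B \<in> Z" using XY by blast
      then show "A \<inter> B \<in> \<Union>C" using CF unfolding F_def by blast
    qed
  qed
  then obtain H where H: "H \<in> F" and max: "\<And>X. X \<in> F \<Longrightarrow> H \<subseteq> X \<Longrightarrow> X = H" by blast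
  have HM: "\<B> \<subseteq> H" "H \<subseteq> sets M" and HI: "\<And>A B. A \<in> H \<Longrightarrow> B \<in> H \<Longrightarrow> A \<inter> B \<in> H"
    and HN: "\<And>A. A \<in> H \<Longrightarrow> \<not> (AE x in M. x \<notin> A)"
    using H by (auto simp: F_def)
  have extend: "A \<in> H" if A: "A \<in> sets M" and meets: "\<And>B. B \<in> H \<Longrightarrow> \<not> (AE x in M. x \<notin> B \<inter> A)" for A
  proof -
    \<comment> \<open>\<open>A\<close> is adjoined separately from its traces, since
      \<open>H\<close> is not yet known to contain the whole space.\<close>
    let ?X = "H \<union> (\<lambda>B. B \<inter> A) ` H \<union> {A}"
    obtain B0 where "B0 \<in> H" using assms(2) HM by auto
    have "\<not> (AE x in M. x \<notin> A)"
    proof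
      assume "AE x in M. x \<notin> A"
      then have "AE x in M. x \<notin> B0 \<inter> A" by eventually_elim auto
      with meets[OF \<open>B0 \<in> H\<close>] show False by simp
    qed
    have "?X \<in> F"
      unfolding F_def
    proof (intro CollectI conjI ballI)
      show "\<B> \<subseteq> ?X" "?X \<subseteq> sets M" using HM A by auto
      fix C assume C: "C \<in> ?X"
      then show "\<not> (AE x in M. x \<notin> C)" using HN meets \<open>\<not> (AE x in M. x \<notin> A)\<close> by auto
      fix D assume D: "D \<in> ?X"
      have *: "E \<inter> (E' \<inter> A) = (E \<inter> E') \<inter> A" "E \<inter> A \<inter> E' = (E \<inter> E') \<inter> A"
        "E \<inter> A \<inter> A = E \<inter> A" "A \<inter> (E \<inter> A) = E \<inter> A" "A \<inter> E = E \<inter> A" for E E'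
        by auto
      from C D show "C \<inter> D \<in> ?X"
        by (elim UnE imageE singletonE) (simp_all add: * HI)
    qed
    from max[OF this] show ?thesis by auto
  qed
  have "ae_ultrafilter M H"
    unfolding ae_ultrafilter_def
  proof (intro conjI ballI)
    fix A assume A: "A \<in> sets M"
    show "space M - A \<in> H \<longleftrightarrow> A \<notin> H"
    proof
      assume "space M - A \<in> H"
      moreover have "AE x in M. x \<notin> (space M - A) \<inter> A" by auto
      ultimately show "A \<notin> H" using HI HN by blast
    next
      assume "A \<notin> H"
      with extend[OF A] obtain B where B: "B \<in> H" "AE x in M. x \<notin> B \<inter> A" by auto
      show "space M - A \<in> H"
      proof (rule extend)
        fix C assume C: "C \<in> H"
        show "\<not> (AE x in M. x \<notin> C \<inter> (space M - A))"
        proof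
          assume "AE x in M. x \<notin> C \<inter> (space M - A)"
          with B(2) AE_space have "AE x in M. x \<notin> C \<inter> B" by eventually_elim auto
          with HN HI B(1) C show False by blast
        qed
      qed (use A in auto)
    qed
  qed (use HM HI HN in auto)
  then show thesis using HM that by blast
qed

text \<open>Each algebraic law of a lifting holds point by point, as a law of ultrafilters.
  Completeness gives measurability, since the value at \<open>A\<close> differs from
  \<open>A\<close> by a null set.\<close>

lemma (in complete_measure) lifting_of_ultrafilters:
  assumes U: "\<And>x. x \<in> space M \<Longrightarrow> ae_ultrafilter M (U x)"
    and ae: "\<And>A. A \<in> sets M \<Longrightarrow> AE x in M. A \<in> U x \<longleftrightarrow> x \<in> A"
  shows "(\<lambda>A. {x \<in> space M. A \<in> U x}) \<in> liftings M"
proof -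
  have ae': "AE x in M. x \<in> {x \<in> space M. A \<in> U x} \<longleftrightarrow> x \<in> A" if "A \<in> sets M" for A
    using ae[OF that] AE_space by eventually_elim auto
  let ?\<delta> = "\<lambda>A. {x \<in> space M. A \<in> U x}"
  have meas: "?\<delta> A \<in> sets M" if "A \<in> sets M" for A
  proof (rule in_sets_AE[OF _ that])
    show "AE x in M. x \<in> A \<longleftrightarrow> x \<in> ?\<delta> A"
      using ae'[OF that] by eventually_elim auto
  qed auto
  have "lower_density M ?\<delta>"
    unfolding lower_density_def
  proof (intro conjI ballI impI)
    fix A B assume AB: "A \<in> sets M" "B \<in> sets M"
    show "?\<delta> A = ?\<delta> B" if "AE x in M. x \<in> A \<longleftrightarrow> x \<in> B"
      using ae_ultrafilter_cong[OF U AB that] by blast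
    show "?\<delta> (A \<inter> B) = ?\<delta> A \<inter> ?\<delta> B"
      using ae_ultrafilter_Int_iff[OF U AB] by blast
  next
    show "?\<delta> {} = {}" "?\<delta> (space M) = space M"
      using ae_ultrafilter_empty[OF U] ae_ultrafilter_space[OF U] by blast+
  qed (fact meas ae')+
  moreover have "?\<delta> (space M - A) = space M - ?\<delta> A" if "A \<in> sets M" for A
    using ae_ultrafilter_compl[OF U that] by blast
  ultimately show ?thesis
    unfolding liftings_def by simp
qed

text \<open>Converse passage. Null sets are excluded because a lifting sends them all to
  \<open>{}\<close>.\<close>

lemma ultrafilter_of_lifting:
  assumes \<delta>: "\<delta> \<in> liftings M" and x: "x \<in> space M"
  shows "ae_ultrafilter M {A \<in> sets M. x \<in> \<delta> A}"
proof -
  have ld: "lower_density M \<delta>" and compl: "\<And>A. A \<in> sets M \<Longrightarrow> \<delta> (space M - A) = space M - \<delta> A"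
    using \<delta> by (simp_all add: liftings_def)
  have Int: "\<And>A B. A \<in> sets M \<Longrightarrow> B \<in> sets M \<Longrightarrow> \<delta> (A \<inter> B) = \<delta> A \<inter> \<delta> B"
    and eq: "\<And>A B. A \<in> sets M \<Longrightarrow> B \<in> sets M \<Longrightarrow> AE x in M. x \<in> A \<longleftrightarrow> x \<in> B \<Longrightarrow> \<delta> A = \<delta> B"
    and emp: "\<delta> {} = {}"
    using ld unfolding lower_density_def by meson+
  have null: "\<delta> A = {}" if "A \<in> sets M" "AE x in M. x \<notin> A" for A
  proof -
    have "AE x in M. x \<in> A \<longleftrightarrow> x \<in> {}" using that(2) by eventually_elim auto
    then show ?thesis using eq[OF that(1), of "{}"] emp by simp
  qed
  show ?thesis
    unfolding ae_ultrafilter_def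
  proof (intro conjI ballI)
    fix A assume A: "A \<in> {A \<in> sets M. x \<in> \<delta> A}"
    then show "\<not> (AE x in M. x \<notin> A)" using null by auto
    fix B assume "B \<in> {A \<in> sets M. x \<in> \<delta> A}"
    then show "A \<inter> B \<in> {A \<in> sets M. x \<in> \<delta> A}" using A by (auto simp: Int)
  next
    fix A assume A: "A \<in> sets M"
    then show "space M - A \<in> {A \<in> sets M. x \<in> \<delta> A} \<longleftrightarrow> A \<notin> {A \<in> sets M. x \<in> \<delta> A}"
      using x compl[OF A] by simp
  qed blast
qed

section \<open>Liftings of functions\<close>

text \<open>A filter on points, so that the value of a function lifting at a point becomes a limit
  and inherits the algebraic laws of limits.\<close>

definition filter_of :: "'a set set \<Rightarrow> 'a filter" where
  "filter_of U = (INF A\<in>U. principal A)"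

lemma eventually_filter_of:
  assumes U: "ae_ultrafilter M U"
  shows "eventually P (filter_of U) \<longleftrightarrow> (\<exists>A\<in>U. \<forall>z\<in>A. P z)"
  unfolding filter_of_def
proof (subst eventually_INF_base)
  show "U \<noteq> {}" using ae_ultrafilter_space[OF U] by auto
  fix A B assume "A \<in> U" "B \<in> U"
  then show "\<exists>C\<in>U. principal C \<le> inf (principal A) (principal B)"
    using ae_ultrafilter_Int[OF U] by (intro bexI[of _ "A \<inter> B"]) auto
qed (simp add: eventually_principal)

lemma filter_of_not_bot: "ae_ultrafilter M U \<Longrightarrow> filter_of U \<noteq> bot"
  using eventually_filter_of[of M U "\<lambda>_. False"] ae_ultrafilter_empty[of M U]
  by (auto simp: trivial_limit_def)

lemma eventually_filter_of_AE:
  assumes U: "ae_ultrafilter M U" and "AE x in M. P x"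
  shows "eventually P (filter_of U)"
proof -
  obtain N where N: "N \<in> null_sets M" "{x \<in> space M. \<not> P x} \<subseteq> N"
    using assms(2) unfolding eventually_ae_filter by blast
  have "AE x in M. x \<in> space M - N"
    using AE_not_in[OF N(1)] AE_space by eventually_elim auto
  then have "space M - N \<in> U"
    using N(1) by (intro ae_ultrafilter_AE[OF U]) auto
  then show ?thesis using N(2) unfolding eventually_filter_of[OF U] by blast
qed

lemma Linf_norm_finite_iff:
  assumes "f \<in> borel_measurable M"
  shows "Linf_norm M f < \<infinity> \<longleftrightarrow> (\<exists>c. AE x in M. \<bar>f x\<bar> \<le> c)"
proof
  assume fin: "Linf_norm M f < \<infinity>"
  obtain c :: real where c: "Linf_norm M f \<le> ereal c"
    using fin by (cases "Linf_norm M f") auto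
  have "AE x in M. ereal \<bar>f x\<bar> \<le> Linf_norm M f"
    unfolding Linf_norm_def by (rule esssup_AE)
  then have "AE x in M. \<bar>f x\<bar> \<le> c"
  proof eventually_elim
    case (elim x)
    then have "ereal \<bar>f x\<bar> \<le> ereal c" using c by (rule order_trans)
    then show ?case by simp
  qed
  then show "\<exists>c. AE x in M. \<bar>f x\<bar> \<le> c" ..
next
  assume "\<exists>c. AE x in M. \<bar>f x\<bar> \<le> c"
  then obtain c where "AE x in M. \<bar>f x\<bar> \<le> c" ..
  then have "Linf_norm M f \<le> ereal c"
    unfolding Linf_norm_def using assms by (intro esssup_I) auto
  then show "Linf_norm M f < \<infinity>" by auto
qed

text \<open>The limit is the supremum of the \<open>q\<close> for which \<open>{q < f}\<close>
  belongs to \<open>U\<close>: below it these sets are members, above it their complements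
  are.\<close>

lemma tendsto_filter_of:
  fixes f :: "'a \<Rightarrow> real"
  assumes U: "ae_ultrafilter M U" and f: "f \<in> borel_measurable M" and c: "AE x in M. \<bar>f x\<bar> \<le> c"
  obtains l where "(f \<longlongrightarrow> l) (filter_of U)"
proof -
  define T where "T = {q. {z \<in> space M. q < f z} \<in> U}"
  have sets: "{z \<in> space M. q < f z} \<in> sets M" "{z \<in> space M. f z \<le> q} \<in> sets M" for q
    using f by measurable
  have "q \<le> c" if "q \<in> T" for q
  proof (rule ccontr)
    assume "\<not> q \<le> c"
    have "AE z in M. z \<notin> {z \<in> space M. q < f z}"
      using c by eventually_elim (use \<open>\<not> q \<le> c\<close> in auto)
    then show False using that ae_ultrafilter_not_null[OF U] unfolding T_def by blast
  qed
  then have bdd: "bdd_above T" by (auto simp: bdd_above_def)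
  \<comment> \<open>The level lies strictly below the essential lower bound \<open>- c\<close>,
    because \<open>T\<close> is defined by a strict inequality.\<close>
  have "- c - 1 \<in> T"
    unfolding T_def mem_Collect_eq
  proof (rule ae_ultrafilter_AE[OF U sets(1)])
    show "AE x in M. x \<in> {z \<in> space M. - c - 1 < f z}"
      using c AE_space by eventually_elim auto
  qed
  then have ne: "T \<noteq> {}" by auto
  have "(f \<longlongrightarrow> Sup T) (filter_of U)"
  proof (rule order_tendstoI)
    fix a assume "a < Sup T"
    then obtain q where "q \<in> T" "a < q" using less_cSup_iff[OF ne bdd] by auto
    then show "eventually (\<lambda>x. a < f x) (filter_of U)"
      unfolding eventually_filter_of[OF U]
      by (intro bexI[of _ "{z \<in> space M. q < f z}"]) (auto simp: T_def)
  next
    fix a assume "Sup T < a"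
    then obtain q where q: "Sup T < q" "q < a" using dense by blast
    then have "q \<notin> T" using cSup_upper[OF _ bdd, of q] by auto
    then have "space M - {z \<in> space M. q < f z} \<in> U"
      using ae_ultrafilter_compl[OF U sets(1)[of q]] by (simp add: T_def)
    then show "eventually (\<lambda>x. f x < a) (filter_of U)"
      unfolding eventually_filter_of[OF U] using q(2)
      by (intro bexI[of _ "space M - {z \<in> space M. q < f z}"]) auto
  qed
  then show thesis by (rule that)
qed

lemma (in complete_measure) borel_measurable_AE:
  fixes f g :: "'a \<Rightarrow> 'b::topological_space"
  assumes f: "f \<in> borel_measurable M" and eq: "AE x in M. f x = g x"
  shows "g \<in> borel_measurable M"
proof (rule measurableI)
  fix A :: "'b set" assume A: "A \<in> sets borel"
  show "g -` A \<inter> space M \<in> sets M"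
  proof (rule in_sets_AE)
    show "AE x in M. x \<in> f -` A \<inter> space M \<longleftrightarrow> x \<in> g -` A \<inter> space M"
      using eq by eventually_elim auto
    show "f -` A \<inter> space M \<in> sets M" using f A by measurable
  qed auto
qed simp

text \<open>The value of \<open>L f\<close> at \<open>x\<close> is the limit of \<open>f\<close>
  along the ultrafilter that \<delta> attaches to \<open>x\<close>, so linearity, multiplicativity
  and positivity are those of limits. The second conclusion keeps this description available for
  later computations.\<close>

lemma (in complete_measure) function_lifting_exists:
  assumes \<delta>: "\<delta> \<in> liftings M"
  obtains L where "induces_function_lifting M \<delta> L"
    and "\<And>f x l. x \<in> space M \<Longrightarrow> (f \<longlongrightarrow> l) (filter_of {A \<in> sets M. x \<in> \<delta> A}) \<Longrightarrow> L f x = l"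
proof -
  define F where "F x = filter_of {A \<in> sets M. x \<in> \<delta> A}" for x
  \<comment> \<open>\<open>Lim\<close> is total; \<open>lim\<close> below shows that it is a true
    limit for essentially bounded \<open>f\<close> at points of the space.\<close>
  define L :: "('a \<Rightarrow> real) \<Rightarrow> 'a \<Rightarrow> real" where "L f x = Lim (F x) f" for f x
  note U = ultrafilter_of_lifting[OF \<delta>]
  have ae: "AE x in M. x \<in> \<delta> A \<longleftrightarrow> x \<in> A" if "A \<in> sets M" for A
    using \<delta> that unfolding liftings_def lower_density_def by blast
  have evI: "eventually P (F x)" if "x \<in> space M" "A \<in> sets M" "x \<in> \<delta> A" "\<And>z. z \<in> A \<Longrightarrow> P z" for P x A
    unfolding F_def eventually_filter_of[OF U[OF that(1)]] using that by blast
  have ev_AE: "eventually P (F x)" if "x \<in> space M" "AE x in M. P x" for P x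
    unfolding F_def by (rule eventually_filter_of_AE[OF U[OF that(1)] that(2)])
  have nb: "F x \<noteq> bot" if "x \<in> space M" for x
    unfolding F_def by (rule filter_of_not_bot[OF U[OF that]])
  have LI: "L f x = l" if "x \<in> space M" "(f \<longlongrightarrow> l) (F x)" for f x l
    unfolding L_def by (rule tendsto_Lim[OF nb that(2)]) fact
  have bdd: "\<exists>c. AE x in M. \<bar>f x\<bar> \<le> c" if "f \<in> ess_bounded M" for f
    using that Linf_norm_finite_iff unfolding ess_bounded_def by blast
  have bm: "f \<in> borel_measurable M" if "f \<in> ess_bounded M" for f
    using that by (simp add: ess_bounded_def)
  have lim: "(f \<longlongrightarrow> L f x) (F x)" if f: "f \<in> ess_bounded M" and x: "x \<in> space M" for f x
  proof -
    obtain c where "AE x in M. \<bar>f x\<bar> \<le> c" using bdd[OF f] ..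
    from tendsto_filter_of[OF U[OF x] bm[OF f] this] obtain l where "(f \<longlongrightarrow> l) (F x)"
      unfolding F_def by blast
    with LI[OF x this] show ?thesis by simp
  qed
  have L_bdd: "\<exists>c. \<forall>x\<in>space M. \<bar>L f x\<bar> \<le> c" if f: "f \<in> ess_bounded M" for f
  proof -
    obtain c where c: "AE x in M. \<bar>f x\<bar> \<le> c" using bdd[OF f] ..
    have "\<bar>L f x\<bar> \<le> c" if x: "x \<in> space M" for x
      by (rule tendsto_upperbound[OF tendsto_rabs[OF lim[OF f x]] ev_AE[OF x c] nb[OF x]])
    then show ?thesis by blast
  qed
  have L_ae: "AE x in M. L f x = f x" if f: "f \<in> ess_bounded M" for f
  proof -
    \<comment> \<open>Off one null set, \<delta> fixes the membership of \<open>x\<close> in all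
      these countably many level sets; a rational strictly between \<open>f x\<close> and
      \<open>L f x\<close> would then contradict the limit.\<close>
    let ?G = "\<lambda>q::rat. {z \<in> space M. of_rat q < f z}"
    let ?H = "\<lambda>q::rat. {z \<in> space M. f z < of_rat q}"
    have sets: "?G q \<in> sets M" "?H q \<in> sets M" for q
      using bm[OF f] by measurable
    have "AE x in M. \<forall>q. (x \<in> \<delta> (?G q) \<longleftrightarrow> x \<in> ?G q) \<and> (x \<in> \<delta> (?H q) \<longleftrightarrow> x \<in> ?H q)"
      unfolding AE_all_countable using ae[OF sets(1)] ae[OF sets(2)] by (intro allI AE_conjI)
    with AE_space show ?thesis
    proof eventually_elim
      case (elim x)
      show ?case
      proof (rule antisym; rule leI; rule notI)
        assume "f x < L f x"
        then obtain q where q: "f x < of_rat q" "of_rat q < L f x"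
          using of_rat_dense by blast
        with elim have "eventually (\<lambda>z. f z \<le> of_rat q) (F x)"
          by (intro evI[of x "?H q"] sets) auto
        from tendsto_upperbound[OF lim[OF f elim(1)] this nb[OF elim(1)]] q show False by simp
      next
        assume "L f x < f x"
        then obtain q where q: "L f x < of_rat q" "of_rat q < f x"
          using of_rat_dense by blast
        with elim have "eventually (\<lambda>z. of_rat q \<le> f z) (F x)"
          by (intro evI[of x "?G q"] sets) auto
        from tendsto_lowerbound[OF lim[OF f elim(1)] this nb[OF elim(1)]] q show False by simp
      qed
    qed
  qed
  have L_meas: "L f \<in> borel_measurable M" if f: "f \<in> ess_bounded M" for f
  proof (rule borel_measurable_AE[OF bm[OF f]])
    show "AE x in M. f x = L f x" using L_ae[OF f] by eventually_elim simp
  qed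
  have "function_lifting M L"
    unfolding function_lifting_def
  proof (intro conjI ballI allI impI)
    fix f x assume f: "f \<in> ess_bounded M" and pos: "\<forall>x\<in>space M. 0 \<le> f x" and x: "x \<in> space M"
    have "AE x in M. 0 \<le> f x" using pos by (auto intro: AE_I2)
    from tendsto_lowerbound[OF lim[OF f x] ev_AE[OF x this] nb[OF x]] show "0 \<le> L f x" .
  next
    fix f g x assume f: "f \<in> ess_bounded M" and g: "g \<in> ess_bounded M" and x: "x \<in> space M"
    show "L (\<lambda>z. a * f z + b * g z) x = a * L f x + b * L g x" for a b
      by (intro LI[OF x] tendsto_intros lim f g x)
    show "L (\<lambda>z. f z * g z) x = L f x * L g x"
      by (intro LI[OF x] tendsto_intros lim f g x)
    assume eq: "AE x in M. f x = g x"
    have "(f \<longlongrightarrow> L g x) (F x)"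
      using tendsto_cong[OF ev_AE[OF x eq]] lim[OF g x] by simp
    then show "L f x = L g x" by (rule LI[OF x])
  next
    fix c x assume x: "x \<in> space M"
    show "L (\<lambda>_. c) x = c" by (intro LI[OF x] tendsto_intros)
  qed (fact L_meas L_bdd L_ae)+
  moreover have "L (indicator A) x = indicator (\<delta> A) x" if A: "A \<in> sets M" and x: "x \<in> space M" for A x
  proof (rule LI[OF x], rule tendsto_eventually)
    \<comment> \<open>Either \<open>A\<close> or its complement belongs to the ultrafilter, so the
      indicator is eventually constant.\<close>
    show "eventually (\<lambda>z. indicator A z = (indicator (\<delta> A) x :: real)) (F x)"
    proof (cases "x \<in> \<delta> A")
      case True
      then show ?thesis by (intro evI[OF x A]) auto
    next
      case False
      then have "x \<in> \<delta> (space M - A)" using \<delta> A x by (simp add: liftings_def)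
      with False A show ?thesis by (intro evI[OF x, of "space M - A"]) auto
    qed
  qed
  ultimately have "induces_function_lifting M \<delta> L"
    unfolding induces_function_lifting_def by blast
  then show thesis by (rule that[OF _ LI[unfolded F_def]])
qed

section \<open>Ranges of partial liftings\<close>

text \<open>A lifting on a sub-\<open>\<sigma>\<close>-algebra that contains the null sets is determined by its range: the
  value at \<open>A\<close> is the unique member of the range that is a.e. equal to \<open>A\<close>. In this encoding, extension
  of liftings is inclusion of families of sets.\<close>

definition lifting_range :: "'a measure \<Rightarrow> 'a set set \<Rightarrow> bool" where
  "lifting_range M \<R> \<longleftrightarrow>
     \<R> \<subseteq> sets M \<and> space M \<in> \<R> \<and> (\<forall>A\<in>\<R>. \<forall>B\<in>\<R>. A \<inter> B \<in> \<R>) \<and> (\<forall>A\<in>\<R>. space M - A \<in> \<R>) \<and>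
     (\<forall>A\<in>\<R>. (AE x in M. x \<notin> A) \<longrightarrow> A = {}) \<and>
     (\<forall>A::nat \<Rightarrow> 'a set. range A \<subseteq> \<R> \<longrightarrow> (\<exists>B\<in>\<R>. AE x in M. x \<in> B \<longleftrightarrow> (\<exists>n. x \<in> A n)))"

lemma lifting_rangeD:
  assumes "lifting_range M \<R>"
  shows lifting_range_sets: "A \<in> \<R> \<Longrightarrow> A \<in> sets M"
    and lifting_range_space: "space M \<in> \<R>"
    and lifting_range_Int: "A \<in> \<R> \<Longrightarrow> B \<in> \<R> \<Longrightarrow> A \<inter> B \<in> \<R>"
    and lifting_range_compl: "A \<in> \<R> \<Longrightarrow> space M - A \<in> \<R>"
    and lifting_range_null: "A \<in> \<R> \<Longrightarrow> AE x in M. x \<notin> A \<Longrightarrow> A = {}"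
proof -
  have *: "\<R> \<subseteq> sets M" "space M \<in> \<R>" "\<forall>A\<in>\<R>. \<forall>B\<in>\<R>. A \<inter> B \<in> \<R>" "\<forall>A\<in>\<R>. space M - A \<in> \<R>"
    "\<forall>A\<in>\<R>. (AE x in M. x \<notin> A) \<longrightarrow> A = {}"
    using assms unfolding lifting_range_def by - (elim conjE, assumption)+
  show "A \<in> \<R> \<Longrightarrow> A \<in> sets M" using *(1) by (rule subsetD)
  show "space M \<in> \<R>" by (fact *(2))
  show "A \<in> \<R> \<Longrightarrow> B \<in> \<R> \<Longrightarrow> A \<inter> B \<in> \<R>" using *(3) by simp
  show "A \<in> \<R> \<Longrightarrow> space M - A \<in> \<R>" using *(4) by simp
  show "A \<in> \<R> \<Longrightarrow> AE x in M. x \<notin> A \<Longrightarrow> A = {}" using *(5) by blast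
qed

lemma lifting_range_UN:
  fixes E :: "nat \<Rightarrow> 'a set"
  assumes "lifting_range M \<R>" "range E \<subseteq> \<R>"
  shows "\<exists>B\<in>\<R>. AE x in M. x \<in> B \<longleftrightarrow> (\<exists>n. x \<in> E n)"
  using assms unfolding lifting_range_def by (elim conjE) (erule allE[of _ E], erule (1) mp)

lemma lifting_range_into_space: "lifting_range M \<R> \<Longrightarrow> A \<in> \<R> \<Longrightarrow> A \<subseteq> space M"
  by (rule sets.sets_into_space) (rule lifting_range_sets)

lemma lifting_range_Diff:
  assumes "lifting_range M \<R>" "A \<in> \<R>" "B \<in> \<R>"
  shows "A - B \<in> \<R>"
proof -
  have "A - B = A \<inter> (space M - B)"
    using lifting_range_into_space[OF assms(1,2)] by blast
  then show ?thesis
    using lifting_range_Int[OF assms(1,2) lifting_range_compl[OF assms(1,3)]] by simp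
qed

lemma lifting_range_Un:
  assumes "lifting_range M \<R>" "A \<in> \<R>" "B \<in> \<R>"
  shows "A \<union> B \<in> \<R>"
proof -
  have "A \<union> B = space M - (space M - A - B)"
    using lifting_range_into_space[OF assms(1,2)] lifting_range_into_space[OF assms(1,3)] by blast
  then show ?thesis
    using lifting_range_compl[OF assms(1)] lifting_range_Diff[OF assms(1)] assms(2,3) by simp
qed

lemma lifting_range_empty: "lifting_range M \<R> \<Longrightarrow> {} \<in> \<R>"
  using lifting_range_compl[of M \<R> "space M"] lifting_range_space[of M \<R>] by simp

text \<open>The difference \<open>A - B\<close> is a null member of the range, hence empty.\<close>

lemma lifting_range_subset:
  assumes "lifting_range M \<R>" "A \<in> \<R>" "B \<in> \<R>" "AE x in M. x \<in> A \<longrightarrow> x \<in> B"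
  shows "A \<subseteq> B"
proof -
  have "AE x in M. x \<notin> A - B" using assms(4) by eventually_elim simp
  from lifting_range_null[OF assms(1) lifting_range_Diff[OF assms(1-3)] this] show ?thesis by blast
qed

lemma lifting_range_eq:
  assumes "lifting_range M \<R>" "A \<in> \<R>" "B \<in> \<R>" "AE x in M. x \<in> A \<longleftrightarrow> x \<in> B"
  shows "A = B"
proof (rule antisym)
  have "AE x in M. x \<in> A \<longrightarrow> x \<in> B"
    using assms(4) by eventually_elim simp
  then show "A \<subseteq> B" by (rule lifting_range_subset[OF assms(1-3)])
  have "AE x in M. x \<in> B \<longrightarrow> x \<in> A"
    using assms(4) by eventually_elim simp
  then show "B \<subseteq> A" by (rule lifting_range_subset[OF assms(1,3,2)])
qed

section \<open>Extension of a range by one set, and Hahn decomposition over a range\<close>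

context prob_space
begin

text \<open>Exhaustion: \<open>C\<close> represents in \<R> a countable union of members almost
  disjoint from \<open>A\<close> whose probabilities tend to the supremum. Maximal probability turns
  into true inclusion, because null members of \<R> are empty.\<close>

lemma lifting_range_hull:
  assumes R: "lifting_range M \<R>" and A: "A \<in> sets M"
  obtains C where "C \<in> \<R>" "AE x in M. x \<notin> C \<inter> A"
    and "\<And>E. E \<in> \<R> \<Longrightarrow> AE x in M. x \<notin> E \<inter> A \<Longrightarrow> E \<subseteq> C"
proof -
  define F where "F = {E \<in> \<R>. AE x in M. x \<notin> E \<inter> A}"
  have F_R: "E \<in> F \<Longrightarrow> E \<in> \<R>" and F_ae: "E \<in> F \<Longrightarrow> AE x in M. x \<notin> E \<inter> A" for E
    by (simp_all add: F_def)
  note sets = lifting_range_sets[OF R]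
  define s where "s = Sup (prob ` F)"
  have ne: "prob ` F \<noteq> {}"
    using lifting_range_empty[OF R] by (auto simp: F_def)
  have bdd: "bdd_above (prob ` F)"
    by (intro bdd_aboveI[of _ 1]) auto
  have "\<exists>E\<in>F. s - 1 / Suc n < prob E" for n
    using less_cSup_iff[OF ne bdd, of "s - 1 / Suc n"] by (auto simp: s_def)
  then obtain E where EF: "\<And>n. E n \<in> F" and Es: "\<And>n. s - 1 / Suc n < prob (E n)" by metis
  obtain C where C: "C \<in> \<R>" "AE x in M. x \<in> C \<longleftrightarrow> (\<exists>n. x \<in> E n)"
    using lifting_range_UN[OF R, of E] EF F_R by blast
  have "AE x in M. \<forall>n. x \<notin> E n \<inter> A"
    using F_ae[OF EF] by (simp only: AE_all_countable simp_thms)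
  with C(2) have CA: "AE x in M. x \<notin> C \<inter> A" by eventually_elim auto
  have "prob (E n) \<le> prob C" for n
  proof (rule finite_measure_mono_AE)
    show "AE x in M. x \<in> E n \<longrightarrow> x \<in> C" using C(2) by eventually_elim auto
  qed (use C sets in auto)
  then have "s \<le> prob C + 1 / Suc n" for n
    using Es[of n] by (smt (verit))
  then have "s \<le> prob C"
    by (meson field_le_epsilon nat_approx_posE add_left_mono less_imp_le order_trans)
  have "D \<subseteq> C" if D: "D \<in> \<R>" "AE x in M. x \<notin> D \<inter> A" for D
  proof -
    \<comment> \<open>\<open>D \<union> C\<close> competes for the same supremum, which forces
      \<open>D - C\<close> to be null.\<close>
    have "AE x in M. x \<notin> (D \<union> C) \<inter> A" using D(2) CA by eventually_elim auto
    then have "D \<union> C \<in> F" using lifting_range_Un[OF R D(1) C(1)] unfolding F_def by blast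
    then have "prob (D \<union> C) \<le> s" unfolding s_def by (intro cSup_upper imageI bdd)
    moreover have "prob (D \<union> C) = prob C + prob (D - C)"
      using finite_measure_Union[of C "D - C"] sets[OF C(1)] sets[OF D(1)] by (simp add: Un_commute)
    ultimately have "prob (D - C) = 0"
      using \<open>s \<le> prob C\<close> measure_nonneg[of M "D - C"] by linarith
    then have "AE x in M. x \<notin> D - C"
      using prob_eq_0[of "D - C"] sets[OF C(1)] sets[OF D(1)] by blast
    from lifting_range_null[OF R lifting_range_Diff[OF R D(1) C(1)] this] show ?thesis by blast
  qed
  with C(1) CA show thesis by (rule that)
qed

text \<open>A set \<open>(E \<inter> A) \<union> (F - A)\<close> with \<open>E\<close> and
  \<open>F\<close> in \<R> may be null without being empty. Replacing \<open>A\<close> by a suitable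
  a.e. equal set \<open>A'\<close> removes all such conflicts at once.\<close>

lemma lifting_range_extend:
  assumes R: "lifting_range M \<R>" and A: "A \<in> sets M"
  obtains \<R>' A' where "lifting_range M \<R>'" "\<R> \<subseteq> \<R>'" "A' \<in> \<R>'" "AE x in M. x \<in> A' \<longleftrightarrow> x \<in> A"
proof -
  note sets = lifting_range_sets[OF R]
  \<comment> \<open>\<open>C\<close> is the largest member a.e. disjoint from \<open>A\<close>, and
    \<open>D\<close> is the largest member a.e. contained in \<open>A\<close>.\<close>
  obtain C where C: "C \<in> \<R>" "AE x in M. x \<notin> C \<inter> A"
    and C_max: "\<And>E. E \<in> \<R> \<Longrightarrow> AE x in M. x \<notin> E \<inter> A \<Longrightarrow> E \<subseteq> C"
    using lifting_range_hull[OF R A] by blast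
  obtain D where D: "D \<in> \<R>" "AE x in M. x \<notin> D \<inter> (space M - A)"
    and D_max: "\<And>E. E \<in> \<R> \<Longrightarrow> AE x in M. x \<notin> E \<inter> (space M - A) \<Longrightarrow> E \<subseteq> D"
    using lifting_range_hull[OF R, of "space M - A"] A by blast
  have "AE x in M. x \<notin> C \<inter> D"
    using C(2) D(2) AE_space by eventually_elim auto
  with lifting_range_null[OF R] lifting_range_Int[OF R C(1) D(1)] have CD: "C \<inter> D = {}" by blast
  \<comment> \<open>The new representative is made to contain \<open>D\<close> and to avoid
    \<open>C\<close>, which is consistent as \<open>C\<close> and \<open>D\<close> are
    disjoint.\<close>
  define A' where "A' = (A \<union> D) - C"
  have A': "A' \<in> sets M" "A' \<subseteq> space M"
    using A sets[OF C(1)] sets[OF D(1)] sets.sets_into_space[OF A] lifting_range_into_space[OF R D(1)]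
    by (auto simp: A'_def)
  have A'_A: "AE x in M. x \<in> A' \<longleftrightarrow> x \<in> A"
    using C(2) D(2) AE_space by eventually_elim (auto simp: A'_def)
  define join where "join E F = (E \<inter> A') \<union> (F - A')" for E F
  define \<R>' where "\<R>' = {join E F | E F. E \<in> \<R> \<and> F \<in> \<R>}"
  have joinI: "join E F \<in> \<R>'" if "E \<in> \<R>" "F \<in> \<R>" for E F
    using that by (auto simp: \<R>'_def)
  have sub: "E \<subseteq> space M" if "E \<in> \<R>" for E using lifting_range_into_space[OF R that] .
  have "lifting_range M \<R>'"
    unfolding lifting_range_def
  proof (intro conjI ballI allI impI)
    show "\<R>' \<subseteq> sets M" using sets A' by (auto simp: \<R>'_def join_def)
    have "join (space M) (space M) = space M" using A' by (auto simp: join_def)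
    with joinI[OF lifting_range_space[OF R] lifting_range_space[OF R]] show "space M \<in> \<R>'" by simp
  next
    fix B1 B2 assume "B1 \<in> \<R>'" "B2 \<in> \<R>'"
    then obtain E1 F1 E2 F2 where *: "E1 \<in> \<R>" "F1 \<in> \<R>" "E2 \<in> \<R>" "F2 \<in> \<R>"
      and B: "B1 = join E1 F1" "B2 = join E2 F2" by (auto simp: \<R>'_def)
    have "B1 \<inter> B2 = join (E1 \<inter> E2) (F1 \<inter> F2)" unfolding B join_def by blast
    with * joinI lifting_range_Int[OF R] show "B1 \<inter> B2 \<in> \<R>'" by simp
  next
    fix B assume "B \<in> \<R>'"
    then obtain E F where *: "E \<in> \<R>" "F \<in> \<R>" and B: "B = join E F" by (auto simp: \<R>'_def)
    have "space M - B = join (space M - E) (space M - F)" using A'(2) unfolding B join_def by blast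
    with * joinI lifting_range_compl[OF R] show "space M - B \<in> \<R>'" by simp
    \<comment> \<open>If \<open>join E F\<close> is null, then \<open>E \<subseteq> C\<close> misses
      \<open>A'\<close> and \<open>F \<subseteq> D\<close> lies inside \<open>A'\<close>, so nothing
      remains.\<close>
    assume null: "AE x in M. x \<notin> B"
    have "AE x in M. x \<notin> E \<inter> A"
      using null A'_A by eventually_elim (auto simp: B join_def)
    then have "E \<subseteq> C" by (rule C_max[OF *(1)])
    moreover have "AE x in M. x \<notin> F \<inter> (space M - A)"
      using null A'_A by eventually_elim (auto simp: B join_def)
    then have "F \<subseteq> D" by (rule D_max[OF *(2)])
    ultimately show "B = {}" using CD unfolding B join_def A'_def by blast
  next
    fix B :: "nat \<Rightarrow> 'a set" assume "range B \<subseteq> \<R>'"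
    then have "\<exists>E F. E \<in> \<R> \<and> F \<in> \<R> \<and> B n = join E F" for n unfolding \<R>'_def by blast
    then obtain E F where *: "\<And>n. E n \<in> \<R>" "\<And>n. F n \<in> \<R>" and B: "\<And>n. B n = join (E n) (F n)"
      by metis
    obtain E' where E': "E' \<in> \<R>" "AE x in M. x \<in> E' \<longleftrightarrow> (\<exists>n. x \<in> E n)"
      using lifting_range_UN[OF R, of E] * by blast
    obtain F' where F': "F' \<in> \<R>" "AE x in M. x \<in> F' \<longleftrightarrow> (\<exists>n. x \<in> F n)"
      using lifting_range_UN[OF R, of F] * by blast
    have "AE x in M. x \<in> join E' F' \<longleftrightarrow> (\<exists>n. x \<in> B n)"
      using E'(2) F'(2) by eventually_elim (auto simp: B join_def)
    with joinI[OF E'(1) F'(1)] show "\<exists>B'\<in>\<R>'. AE x in M. x \<in> B' \<longleftrightarrow> (\<exists>n. x \<in> B n)" by blast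
  qed
  moreover have "\<R> \<subseteq> \<R>'"
  proof
    fix E assume "E \<in> \<R>"
    moreover have "E = join E E" by (auto simp: join_def)
    ultimately show "E \<in> \<R>'" using joinI by metis
  qed
  moreover have "A' = join (space M) {}" using A'(2) by (auto simp: join_def)
  then have "A' \<in> \<R>'" using joinI[OF lifting_range_space[OF R] lifting_range_empty[OF R]] by simp
  ultimately show thesis using A'_A by (rule that)
qed

text \<open>Hahn decomposition for \<open>prob (A \<inter> B)\<close> and \<open>t * prob B\<close>
  as functions of \<open>B\<close>. The set \<open>V\<close> stands for the event that the
  conditional probability of \<open>A\<close> given \<R> is at least \<open>t\<close>.\<close>

lemma lifting_range_Hahn:
  assumes R: "lifting_range M \<R>" and A: "A \<in> sets M" and t: "0 \<le> t"
  obtains V where "V \<in> \<R>"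
    and "\<And>B. B \<in> \<R> \<Longrightarrow> B \<subseteq> V \<Longrightarrow> t * prob B \<le> prob (A \<inter> B)"
    and "\<And>B. B \<in> \<R> \<Longrightarrow> B \<inter> V = {} \<Longrightarrow> prob (A \<inter> B) \<le> t * prob B"
proof -
  note sets = lifting_range_sets[OF R]
  \<comment> \<open>\<R> is closed under countable unions only up to null sets; its saturation
    \<open>N\<close> under a.e. equality is a true sigma-algebra.\<close>
  define N where "N = {B \<in> sets M. \<exists>C\<in>\<R>. AE x in M. x \<in> C \<longleftrightarrow> x \<in> B}"
  have "sigma_algebra (space M) N"
    unfolding sigma_algebra_iff2
  proof (intro conjI ballI allI impI)
    show "N \<subseteq> Pow (space M)" by (auto simp: N_def dest: sets.sets_into_space)
    show "{} \<in> N" using lifting_range_empty[OF R] by (auto simp: N_def intro!: bexI[of _ "{}"])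
  next
    fix B assume "B \<in> N"
    then obtain C where C: "C \<in> \<R>" "AE x in M. x \<in> C \<longleftrightarrow> x \<in> B" and B: "B \<in> sets M"
      by (auto simp: N_def)
    have "AE x in M. x \<in> space M - C \<longleftrightarrow> x \<in> space M - B" using C(2) by eventually_elim auto
    then show "space M - B \<in> N"
      using lifting_range_compl[OF R C(1)] B unfolding N_def by blast
  next
    fix B :: "nat \<Rightarrow> 'a set" assume B: "range B \<subseteq> N"
    then have "\<exists>C. C \<in> \<R> \<and> (AE x in M. x \<in> C \<longleftrightarrow> x \<in> B n)" for n unfolding N_def by blast
    then obtain C where C: "\<And>n. C n \<in> \<R>" "\<And>n. AE x in M. x \<in> C n \<longleftrightarrow> x \<in> B n" by metis
    obtain C' where C': "C' \<in> \<R>" "AE x in M. x \<in> C' \<longleftrightarrow> (\<exists>n. x \<in> C n)"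
      using lifting_range_UN[OF R, of C] C by blast
    have "AE x in M. \<forall>n. x \<in> C n \<longleftrightarrow> x \<in> B n" using C(2) by (simp only: AE_all_countable simp_thms)
    with C'(2) have "AE x in M. x \<in> C' \<longleftrightarrow> x \<in> (\<Union>n. B n)" by eventually_elim auto
    moreover have "(\<Union>n. B n) \<in> sets M" using B by (auto simp: N_def)
    ultimately show "(\<Union>n. B n) \<in> N" using C'(1) unfolding N_def by blast
  qed
  then have sets_sigma: "sets (sigma (space M) N) = N" by (rule sigma_algebra.sets_measure_of_eq)
  have N_M: "N \<subseteq> sets M" by (auto simp: N_def)
  \<comment> \<open>On \<open>N\<close>, the measure \<open>dA\<close> is
    \<open>prob (A \<inter> B)\<close> and \<open>tM\<close> is \<open>t * prob B\<close>, as
    functions of \<open>B\<close>.\<close>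
  define dA where "dA = restr_to_subalg (density M (indicator A)) (sigma (space M) N)"
  define tM where "tM = restr_to_subalg (scale_measure (ennreal t) M) (sigma (space M) N)"
  have sub: "subalgebra (density M (indicator A)) (sigma (space M) N)"
    "subalgebra (scale_measure (ennreal t) M) (sigma (space M) N)"
    using N_M by (auto simp: subalgebra_def sets_sigma space_measure_of_conv space_scale_measure)
  have sets_dA: "sets dA = N" and sets_tM: "sets tM = N"
    using sets_restr_to_subalg[OF sub(1)] sets_restr_to_subalg[OF sub(2)]
    by (simp_all add: dA_def tM_def sets_sigma)
  have em_dA: "emeasure dA B = ennreal (prob (A \<inter> B))" if "B \<in> N" for B
    using that N_M A unfolding dA_def
    by (subst emeasure_restr_to_subalg[OF sub(1)])
      (auto simp: sets_sigma emeasure_restricted emeasure_eq_measure)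
  have em_tM: "emeasure tM B = ennreal (t * prob B)" if "B \<in> N" for B
    using that t unfolding tM_def
    by (subst emeasure_restr_to_subalg[OF sub(2)])
      (auto simp: sets_sigma emeasure_eq_measure ennreal_mult)
  have "space M \<in> N" using lifting_range_space[OF R] by (auto simp: N_def intro!: bexI[of _ "space M"])
  have "finite_measure dA" "finite_measure tM"
    using em_dA[OF \<open>space M \<in> N\<close>] em_tM[OF \<open>space M \<in> N\<close>]
    by (auto intro!: finite_measureI simp: dA_def tM_def space_restr_to_subalg space_scale_measure)
  from finite_unsigned_Hahn_decomposition[OF this] obtain Y where Y: "Y \<in> N"
    and Y1: "\<And>X. X \<in> N \<Longrightarrow> X \<subseteq> Y \<Longrightarrow> emeasure tM X \<le> emeasure dA X"
    and Y2: "\<And>X. X \<in> N \<Longrightarrow> X \<inter> Y = {} \<Longrightarrow> emeasure dA X \<le> emeasure tM X"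
    by (auto simp: sets_dA sets_tM)
  then obtain V where V: "V \<in> \<R>" "AE x in M. x \<in> V \<longleftrightarrow> x \<in> Y" and YM: "Y \<in> sets M"
    by (auto simp: N_def)
  have repl: "prob B = prob X" "prob (A \<inter> B) = prob (A \<inter> X)" "X \<in> N"
    if B: "B \<in> \<R>" and X: "X \<in> sets M" "AE x in M. x \<in> B \<longleftrightarrow> x \<in> X" for B X
  proof -
    show "X \<in> N" using that unfolding N_def by blast
    show "prob B = prob X"
      using X(2) by (rule measure_eq_AE) (use sets[OF B] X in auto)
    have "AE x in M. x \<in> A \<inter> B \<longleftrightarrow> x \<in> A \<inter> X" using X(2) by eventually_elim auto
    then show "prob (A \<inter> B) = prob (A \<inter> X)"
      by (rule measure_eq_AE) (use sets[OF B] X A in auto)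
  qed
  show thesis
  proof (rule that[OF V(1)])
    fix B assume B: "B \<in> \<R>" "B \<subseteq> V"
    \<comment> \<open>\<open>V\<close> agrees with the Hahn set \<open>Y\<close> only a.e., so
      \<open>B\<close> is cut down to \<open>B \<inter> Y\<close>, which changes neither
      probability.\<close>
    have "AE x in M. x \<in> B \<longleftrightarrow> x \<in> B \<inter> Y" using V(2) by eventually_elim (use B in auto)
    note r = repl[OF B(1) _ this]
    have "B \<inter> Y \<in> sets M" using sets[OF B(1)] YM by auto
    with Y1[of "B \<inter> Y"] r(3) have "t * prob (B \<inter> Y) \<le> prob (A \<inter> (B \<inter> Y))"
      by (simp add: em_dA em_tM)
    with r(1,2) \<open>B \<inter> Y \<in> sets M\<close> show "t * prob B \<le> prob (A \<inter> B)" by simp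
  next
    fix B assume B: "B \<in> \<R>" "B \<inter> V = {}"
    have "AE x in M. x \<in> B \<longleftrightarrow> x \<in> B - Y" using V(2) by eventually_elim (use B in auto)
    note r = repl[OF B(1) _ this]
    have "B - Y \<in> sets M" using sets[OF B(1)] YM by auto
    moreover have "(B - Y) \<inter> Y = {}" by blast
    ultimately have "prob (A \<inter> (B - Y)) \<le> t * prob (B - Y)"
      using Y2[OF r(3)] r(3) t by (simp add: em_dA em_tM)
    with r(1,2) \<open>B - Y \<in> sets M\<close> show "prob (A \<inter> B) \<le> t * prob B" by simp
  qed
qed

section \<open>Events approximated in probability by an algebra\<close>

definition approximable :: "'a set set \<Rightarrow> 'a set set" where
  "approximable \<A> = {A \<in> events. \<forall>e>0. \<exists>B\<in>\<A>. prob (sym_diff A B) < e}"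

lemma approximableD:
  assumes "A \<in> approximable \<A>" "0 < e"
  obtains B where "B \<in> \<A>" "prob (sym_diff A B) < e"
  using assms unfolding approximable_def by blast

lemma approximable_events: "A \<in> approximable \<A> \<Longrightarrow> A \<in> events"
  by (simp add: approximable_def)

lemma approximable_self:
  assumes "A \<in> \<A>" "\<A> \<subseteq> events"
  shows "A \<in> approximable \<A>"
  using assms unfolding approximable_def by (auto intro!: bexI[of _ A])

lemma approximable_compl:
  assumes \<A>: "algebra (space M) \<A>" "\<A> \<subseteq> events" and A: "A \<in> approximable \<A>"
  shows "space M - A \<in> approximable \<A>"
  unfolding approximable_def
proof (intro CollectI conjI allI impI)
  show "space M - A \<in> events" using approximable_events[OF A] by auto
  fix e :: real assume "0 < e"
  then obtain B where B: "B \<in> \<A>" "prob (sym_diff A B) < e" by (rule approximableD[OF A])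
  have "A \<subseteq> space M" "B \<subseteq> space M"
    using sets.sets_into_space[OF approximable_events[OF A]] B(1) \<A>(2) sets.sets_into_space by blast+
  then have "sym_diff (space M - A) (space M - B) = sym_diff A B" by blast
  with B algebra.compl_sets[OF \<A>(1) B(1)] show "\<exists>B\<in>\<A>. prob (sym_diff (space M - A) B) < e" by metis
qed

lemma approximable_Int:
  assumes \<A>: "algebra (space M) \<A>" "\<A> \<subseteq> events"
    and A: "A \<in> approximable \<A>" and B: "B \<in> approximable \<A>"
  shows "A \<inter> B \<in> approximable \<A>"
  unfolding approximable_def
proof (intro CollectI conjI allI impI)
  show "A \<inter> B \<in> events" using approximable_events[OF A] approximable_events[OF B] by auto
  fix e :: real assume "0 < e"
  then have e: "0 < e / 2" by simp
  obtain A' where A': "A' \<in> \<A>" "prob (sym_diff A A') < e / 2" by (rule approximableD[OF A e])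
  obtain B' where B': "B' \<in> \<A>" "prob (sym_diff B B') < e / 2" by (rule approximableD[OF B e])
  have sets: "sym_diff A A' \<in> events" "sym_diff B B' \<in> events"
    using approximable_events[OF A] approximable_events[OF B] \<A>(2) A'(1) B'(1) by auto
  have "prob (sym_diff (A \<inter> B) (A' \<inter> B')) \<le> prob (sym_diff A A' \<union> sym_diff B B')"
    by (rule finite_measure_mono) (use sets in auto)
  also have "\<dots> \<le> prob (sym_diff A A') + prob (sym_diff B B')"
    using sets by (rule measure_Un_le)
  finally have "prob (sym_diff (A \<inter> B) (A' \<inter> B')) < e" using A'(2) B'(2) by linarith
  moreover have "A' \<inter> B' \<in> \<A>"
    using semiring_of_sets.Int[OF ring_of_sets.axioms(1)[OF algebra.axioms(1)[OF \<A>(1)]] A'(1) B'(1)] .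
  ultimately show "\<exists>C\<in>\<A>. prob (sym_diff (A \<inter> B) C) < e" by blast
qed

text \<open>Two approximations within \<open>e / 2\<close> are combined by the triangle inequality
  for \<open>prob (sym_diff A B)\<close>. This reduces countable unions to finite ones.\<close>

lemma approximable_idem:
  assumes \<A>: "\<A> \<subseteq> events" and A: "A \<in> events"
    and approx: "\<And>e. 0 < e \<Longrightarrow> \<exists>B\<in>approximable \<A>. prob (sym_diff A B) < e"
  shows "A \<in> approximable \<A>"
  unfolding approximable_def
proof (intro CollectI conjI allI impI)
  fix e :: real assume "0 < e"
  then have e: "0 < e / 2" by simp
  obtain B where B: "B \<in> approximable \<A>" "prob (sym_diff A B) < e / 2" using approx[OF e] by blast
  obtain C where C: "C \<in> \<A>" "prob (sym_diff B C) < e / 2" by (rule approximableD[OF B(1) e])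
  have sets: "sym_diff A B \<in> events" "sym_diff B C \<in> events"
    using A approximable_events[OF B(1)] \<A> C(1) by auto
  have "prob (sym_diff A C) \<le> prob (sym_diff A B \<union> sym_diff B C)"
    by (rule finite_measure_mono) (use sets in auto)
  also have "\<dots> \<le> prob (sym_diff A B) + prob (sym_diff B C)"
    using sets by (rule measure_Un_le)
  finally have "prob (sym_diff A C) < e" using B(2) C(2) by linarith
  with C(1) show "\<exists>C\<in>\<A>. prob (sym_diff A C) < e" by blast
qed fact

text \<open>Finite unions are approximable through complements and intersections, and their
  probabilities increase to that of the whole union.\<close>

lemma approximable_UN:
  assumes \<A>: "algebra (space M) \<A>" "\<A> \<subseteq> events"
    and A: "\<And>n::nat. A n \<in> approximable \<A>"
  shows "(\<Union>n. A n) \<in> approximable \<A>"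
proof (rule approximable_idem[OF \<A>(2)])
  have events: "A n \<in> events" for n by (rule approximable_events[OF A])
  then show "(\<Union>n. A n) \<in> events" by auto
  have fin: "(\<Union>i<n. A i) \<in> approximable \<A>" for n :: nat
  proof (induction n)
    case 0
    have "{} \<in> \<A>"
      using semiring_of_sets.empty_sets[OF ring_of_sets.axioms(1)[OF algebra.axioms(1)[OF \<A>(1)]]] .
    then show ?case using approximable_self \<A>(2) by simp
  next
    case (Suc n)
    have "A i \<subseteq> space M" for i by (rule sets.sets_into_space[OF events])
    then have "(\<Union>i<Suc n. A i) = space M - ((space M - (\<Union>i<n. A i)) \<inter> (space M - A n))"
      by (auto simp: less_Suc_eq)
    moreover have "\<dots> \<in> approximable \<A>"
      by (intro approximable_compl approximable_Int \<A> Suc.IH A)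
    ultimately show ?case by simp
  qed
  fix e :: real assume "0 < e"
  have "(\<lambda>n. prob (\<Union>i<n. A i)) \<longlonglongrightarrow> prob (\<Union>n. \<Union>i<n. A i)"
  proof (rule finite_Lim_measure_incseq)
    show "incseq (\<lambda>n. \<Union>i<n. A i)"
      unfolding incseq_def by (intro allI impI UN_mono) auto
  qed (use events in auto)
  moreover have UN: "(\<Union>n. \<Union>i<n. A i) = (\<Union>n. A n)" by auto
  ultimately have "eventually (\<lambda>n. prob (\<Union>n. A n) - e < prob (\<Union>i<n. A i)) sequentially"
    using \<open>0 < e\<close> by (intro order_tendstoD(1)) auto
  then obtain n where n: "prob (\<Union>n. A n) - e < prob (\<Union>i<n. A i)"
    unfolding eventually_sequentially by blast
  have "sym_diff (\<Union>n. A n) (\<Union>i<n. A i) = (\<Union>n. A n) - (\<Union>i<n. A i)" by auto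
  moreover have "prob ((\<Union>n. A n) - (\<Union>i<n. A i)) = prob (\<Union>n. A n) - prob (\<Union>i<n. A i)"
    by (rule finite_measure_Diff) (use events in auto)
  ultimately show "\<exists>B\<in>approximable \<A>. prob (sym_diff (\<Union>n. A n) B) < e"
    using n fin by (intro bexI[of _ "\<Union>i<n. A i"]) auto
qed

end

section \<open>Increasing sequences of ranges and conditional probabilities\<close>

lemma incseq_algebra_UN:
  assumes A: "\<And>n. algebra X (A n)" and inc: "incseq (A :: nat \<Rightarrow> _)"
  shows "algebra X (\<Union>n. A n)"
  unfolding algebra_iff_Int
proof (intro conjI ballI)
  note A' = A[unfolded algebra_iff_Int]
  show "(\<Union>n. A n) \<subseteq> Pow X" "{} \<in> (\<Union>n. A n)" using A' by blast+
  fix a assume "a \<in> (\<Union>n. A n)"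
  then obtain m where m: "a \<in> A m" by blast
  with A' show "X - a \<in> (\<Union>n. A n)" by blast
  fix b assume "b \<in> (\<Union>n. A n)"
  then obtain n where n: "b \<in> A n" by blast
  have "a \<in> A (max m n)" "b \<in> A (max m n)"
    using m n incseqD[OF inc, of m "max m n"] incseqD[OF inc, of n "max m n"] by auto
  with A' have "a \<inter> b \<in> A (max m n)" by blast
  then show "a \<inter> b \<in> (\<Union>n. A n)" by blast
qed

context prob_space
begin

lemma lifting_range_algebra:
  assumes "lifting_range M \<R>"
  shows "algebra (space M) \<R>"
  unfolding algebra_iff_Int
proof (intro conjI ballI)
  show "\<R> \<subseteq> Pow (space M)" using lifting_range_into_space[OF assms] by blast
qed (simp_all add: lifting_range_empty[OF assms] lifting_range_compl[OF assms] lifting_range_Int[OF assms])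

text \<open>A version of the event that the conditional probability of \<open>A\<close> given \<open>\<R>\<close> is at least
  \<open>1 - e\<close>.\<close>

definition hahn_set :: "'a set set \<Rightarrow> real \<Rightarrow> 'a set \<Rightarrow> 'a set \<Rightarrow> bool" where
  "hahn_set \<R> e A V \<longleftrightarrow> V \<in> \<R> \<and>
     (\<forall>B\<in>\<R>. B \<subseteq> V \<longrightarrow> (1 - e) * prob B \<le> prob (A \<inter> B)) \<and>
     (\<forall>B\<in>\<R>. B \<inter> V = {} \<longrightarrow> prob (A \<inter> B) \<le> (1 - e) * prob B)"

lemma hahn_setD:
  assumes "hahn_set \<R> e A V"
  shows hahn_set_in: "V \<in> \<R>"
    and hahn_set_ge: "B \<in> \<R> \<Longrightarrow> B \<subseteq> V \<Longrightarrow> (1 - e) * prob B \<le> prob (A \<inter> B)"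
    and hahn_set_le: "B \<in> \<R> \<Longrightarrow> B \<inter> V = {} \<Longrightarrow> prob (A \<inter> B) \<le> (1 - e) * prob B"
  using assms unfolding hahn_set_def by blast+

lemma lifting_range_prob_0:
  assumes "lifting_range M \<R>" "B \<in> \<R>" "prob B \<le> 0"
  shows "B = {}"
proof -
  have "prob B = 0" using assms(3) measure_nonneg[of M B] by linarith
  then have "AE x in M. x \<notin> B" using prob_eq_0[OF lifting_range_sets[OF assms(1,2)]] by simp
  then show ?thesis by (rule lifting_range_null[OF assms(1,2)])
qed

text \<open>On the part \<open>D\<close> of \<open>V \<inter> W\<close> outside \<open>Z\<close>,
  each of \<open>A\<close> and \<open>B\<close> has relative probability at least
  \<open>1 - e\<close>, so \<open>A \<inter> B\<close> has at least \<open>1 - 2 * e\<close>,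
  whereas \<open>C\<close> has at most \<open>1 - d\<close>. Hence \<open>D\<close> is null, and as
  a member of \<R> it is empty.\<close>

lemma hahn_set_Int:
  assumes R: "lifting_range M \<R>"
    and A: "A \<in> events" "hahn_set \<R> e A V" and B: "B \<in> events" "hahn_set \<R> e B W"
    and C: "C \<in> events" "hahn_set \<R> d C Z" and sub: "A \<inter> B \<subseteq> C" and ed: "2 * e < d"
  shows "V \<inter> W \<subseteq> Z"
proof -
  define D where "D = V \<inter> W - Z"
  have D: "D \<in> \<R>"
    unfolding D_def by (intro lifting_range_Diff[OF R] lifting_range_Int[OF R] hahn_set_in[OF A(2)]
        hahn_set_in[OF B(2)] hahn_set_in[OF C(2)])
  note DM = lifting_range_sets[OF R D]
  have "(1 - e) * prob D \<le> prob (A \<inter> D)" "(1 - e) * prob D \<le> prob (B \<inter> D)"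
    by (rule hahn_set_ge[OF A(2) D] hahn_set_ge[OF B(2) D]; auto simp: D_def)+
  moreover have "prob (C \<inter> D) \<le> (1 - d) * prob D"
    by (rule hahn_set_le[OF C(2) D]) (auto simp: D_def)
  moreover have "prob (A \<inter> B \<inter> D) \<le> prob (C \<inter> D)"
    using sub C(1) DM by (intro finite_measure_mono) auto
  moreover have "prob (A \<inter> D) + prob (B \<inter> D) = prob (A \<inter> D \<union> B \<inter> D) + prob (A \<inter> B \<inter> D)"
    using measure_Un3[of "A \<inter> D" M "B \<inter> D"] A(1) B(1) DM
    by (simp add: fmeasurable_eq_sets Int_ac)
  moreover have "prob (A \<inter> D \<union> B \<inter> D) \<le> prob D"
    using DM by (intro finite_measure_mono) auto
  ultimately have "(d - 2 * e) * prob D \<le> 0" by (simp add: algebra_simps)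
  with ed have "prob D \<le> 0" by (simp add: mult_le_0_iff)
  then have "D = {}" by (rule lifting_range_prob_0[OF R D])
  then show ?thesis by (auto simp: D_def)
qed

text \<open>The conditional probability of a member of \<R> is its indicator, which reaches a
  threshold strictly between 0 and 1 exactly on the member itself.\<close>

lemma hahn_set_self:
  assumes R: "lifting_range M \<R>" and A: "A \<in> \<R>" and V: "hahn_set \<R> e A V" and e: "0 < e" "e < 1"
  shows "V = A"
proof -
  have 1: "A - V \<in> \<R>" "V - A \<in> \<R>"
    using lifting_range_Diff[OF R] A hahn_set_in[OF V] by blast+
  have "A \<inter> (A - V) = A - V" "A \<inter> (V - A) = {}" "(A - V) \<inter> V = {}" by auto
  with hahn_set_le[OF V 1(1)] hahn_set_ge[OF V 1(2)] have
    "prob (A - V) \<le> (1 - e) * prob (A - V)" "(1 - e) * prob (V - A) \<le> 0" by auto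
  then have "e * prob (A - V) \<le> 0" "(1 - e) * prob (V - A) \<le> 0" by (simp_all add: algebra_simps)
  with e have "prob (A - V) \<le> 0" "prob (V - A) \<le> 0" by (simp_all add: mult_le_0_iff)
  with lifting_range_prob_0[OF R] 1 have "A - V = {}" "V - A = {}" by blast+
  then show ?thesis by auto
qed

lemma hahn_set_null:
  assumes R: "lifting_range M \<R>" and A: "A \<in> events" "AE x in M. x \<notin> A"
    and V: "hahn_set \<R> e A V" and e: "e < 1"
  shows "V = {}"
proof -
  have "prob (A \<inter> V) \<le> prob A"
    using A(1) lifting_range_sets[OF R hahn_set_in[OF V]] by (intro finite_measure_mono) auto
  also have "\<dots> = 0" using A by (simp add: prob_eq_0)
  finally have "(1 - e) * prob V \<le> 0"
    using hahn_set_ge[OF V hahn_set_in[OF V]] by simp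
  with e have "prob V \<le> 0" by (simp add: mult_le_0_iff)
  then show ?thesis by (rule lifting_range_prob_0[OF R hahn_set_in[OF V]])
qed

text \<open>Doob's maximal inequality for the martingale of the conditional probabilities of the complement
  of \<open>A\<close>.\<close>

lemma hahn_set_maximal_inequality:
  assumes R: "\<And>n. lifting_range M (\<R> n)" and inc: "incseq \<R>"
    and A: "A \<in> events" and V: "\<And>n::nat. hahn_set (\<R> n) e A (V n)"
  shows "e * prob (\<Union>n. space M - V n) \<le> prob (space M - A)"
proof -
  have VR: "V n \<in> \<R> n" for n by (rule hahn_set_in[OF V])
  \<comment> \<open>\<open>G n\<close> is the event that the threshold is missed for the first time
    at index \<open>n\<close>.\<close>
  define G where "G = disjointed (\<lambda>n. space M - V n)"
  \<comment> \<open>As the ranges increase, all earlier sets lie in \<open>\<R> n\<close>. So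
    \<open>G n\<close> does too, and the upper bound of the Hahn set at \<open>n\<close> applies to
    it.\<close>
  have "(\<Union>i<k. space M - V i) \<in> \<R> n" if "k \<le> n" for k n
    using that
  proof (induction k)
    case 0
    then show ?case using lifting_range_empty[OF R] by simp
  next
    case (Suc k)
    have "V k \<in> \<R> n" using VR[of k] incseqD[OF inc, of k n] Suc.prems by auto
    then show ?case
      using lifting_range_Un[OF R lifting_range_compl[OF R, of "V k"] Suc.IH] Suc.prems
      by (simp add: lessThan_Suc)
  qed
  then have GR: "G n \<in> \<R> n" for n
    unfolding G_def disjointed_def atLeast0LessThan
    by (intro lifting_range_Diff[OF R] lifting_range_compl[OF R] VR) simp
  have GV: "G n \<inter> V n = {}" for n by (auto simp: G_def disjointed_def)
  have GM: "G n \<in> events" for n by (rule lifting_range_sets[OF R GR])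
  have disj: "disjoint_family G" unfolding G_def by (rule disjoint_family_disjointed)
  have le: "e * prob (G n) \<le> prob (G n - A)" for n
  proof -
    have "prob (A \<inter> G n) \<le> (1 - e) * prob (G n)" by (rule hahn_set_le[OF V GR GV])
    moreover have "prob (G n - A) = prob (G n) - prob (A \<inter> G n)"
      using finite_measure_Diff'[OF GM A, of n] by (simp add: Int_commute)
    ultimately show ?thesis by (simp add: algebra_simps)
  qed
  have "(\<lambda>n. e * prob (G n)) sums (e * prob (\<Union>n. G n))"
    using disj GM by (intro sums_mult finite_measure_UNION) auto
  moreover have "(\<lambda>n. prob (G n - A)) sums prob (\<Union>n. G n - A)"
    using disj GM A by (intro finite_measure_UNION) (auto simp: disjoint_family_on_def)
  ultimately have "e * prob (\<Union>n. G n) \<le> prob (\<Union>n. G n - A)"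
    by (rule sums_le[OF le])
  also have "\<dots> \<le> prob (space M - A)"
    using A sets.sets_into_space[OF GM] by (intro finite_measure_mono) auto
  finally show ?thesis unfolding G_def by (simp only: UN_disjointed_eq)
qed

end

section \<open>Existence of liftings\<close>

locale complete_prob_space = prob_space + complete_measure

context complete_prob_space
begin

text \<open>A lifting is built on the closure \<open>N\<close> of the union of the ranges. The set
  \<open>\<delta> A\<close> collects the points where the chosen versions of the conditional
  probability of \<open>A\<close> given \<open>\<R> n\<close> tend to 1; by martingale convergence
  it contains almost all of \<open>A\<close> when \<open>A \<in> N\<close>. Extending the filter
  base of all \<open>A \<in> N\<close> with \<open>x \<in> \<delta> A\<close> to an ultrafilter at
  each \<open>x\<close> yields the lifting, whose range is the bound.\<close>

lemma lifting_range_seq_bound: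
  assumes R: "\<And>n. lifting_range M (\<R> n)" and inc: "incseq (\<R> :: nat \<Rightarrow> _)"
  obtains \<R>' where "lifting_range M \<R>'" "\<And>n. \<R> n \<subseteq> \<R>'"
proof -
  define \<A> where "\<A> = (\<Union>n. \<R> n)"
  have \<A>: "algebra (space M) \<A>" "\<A> \<subseteq> events"
    unfolding \<A>_def using incseq_algebra_UN[OF lifting_range_algebra[OF R] inc] lifting_range_sets[OF R]
    by blast+
  \<comment> \<open>This closure serves as the completed sigma-algebra generated by all the ranges,
    in the form that \<open>W_ae\<close> uses.\<close>
  define N where "N = approximable \<A>"
  have N_events: "A \<in> N \<Longrightarrow> A \<in> events" for A unfolding N_def by (rule approximable_events)
  have N_compl: "A \<in> N \<Longrightarrow> space M - A \<in> N" for A unfolding N_def by (rule approximable_compl[OF \<A>])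
  have N_Int: "A \<in> N \<Longrightarrow> B \<in> N \<Longrightarrow> A \<inter> B \<in> N" for A B
    unfolding N_def by (rule approximable_Int[OF \<A>])
  have RN: "A \<in> \<R> n \<Longrightarrow> A \<in> N" for A n
    unfolding N_def by (rule approximable_self[OF _ \<A>(2)]) (auto simp: \<A>_def)
  \<comment> \<open>Two thresholds at level \<open>Suc m\<close> must combine into one at level
    \<open>m\<close>, whence \<open>2 * e (Suc m) < e m\<close>; the exponent \<open>Suc m\<close>
    keeps \<open>e 0\<close> below 1.\<close>
  define e where "e m = (1 / 4 :: real) ^ Suc m" for m :: nat
  have e: "0 < e m" "e m < 1" "2 * e (Suc m) < e m" for m
    using power_Suc_less_one[of "1 / 4 :: real" m] by (simp_all add: e_def del: power_Suc) simp
  have "\<exists>V. hahn_set (\<R> n) (e m) A V" if A: "A \<in> events" for A n m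
  proof -
    have "0 \<le> 1 - e m" using e(2)[of m] by simp
    from lifting_range_Hahn[OF R A this] show ?thesis unfolding hahn_set_def by metis
  qed
  then obtain V where V: "\<And>A n m. A \<in> events \<Longrightarrow> hahn_set (\<R> n) (e m) A (V A n m)" by metis
  \<comment> \<open>The inclusion has no exceptional null set, which matters because uncountably
    many events are treated at one and the same point.\<close>
  have V_Int: "V A n (Suc m) \<inter> V B n (Suc m) \<subseteq> V C n m"
    if "A \<in> events" "B \<in> events" "C \<in> events" "A \<inter> B \<subseteq> C" for A B C n m
    by (rule hahn_set_Int[OF R that(1) V[OF that(1)] that(2) V[OF that(2)] that(3) V[OF that(3)] that(4) e(3)])
  have V_self: "V A k m = A" if "A \<in> \<R> n" "n \<le> k" for A n k m
  proof (rule hahn_set_self[OF R _ V e(1,2)])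
    show "A \<in> \<R> k" using that incseqD[OF inc that(2)] by blast
    show "A \<in> events" by (rule lifting_range_sets[OF R that(1)])
  qed
  have V_null: "V A n m = {}" if "A \<in> events" "AE x in M. x \<notin> A" for A n m
    by (rule hahn_set_null[OF R that V[OF that(1)] e(2)])
  have V_events: "V A n m \<in> events" if "A \<in> events" for A n m
    by (rule lifting_range_sets[OF R hahn_set_in[OF V[OF that]]])
  \<comment> \<open>The limit inferior over \<open>n\<close>: the threshold \<open>1 - e m\<close>
    is reached for all large \<open>n\<close>.\<close>
  define W where "W A m = (\<Union>K. \<Inter>n\<in>{K..}. V A n m)" for A m
  have W_iff: "x \<in> W A m \<longleftrightarrow> (\<exists>K. \<forall>n\<ge>K. x \<in> V A n m)" for x A m
    by (auto simp: W_def)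
  have W_events: "W A m \<in> events" if "A \<in> events" for A m
    unfolding W_def using V_events[OF that] by (intro sets.countable_UN sets.countable_INT') auto
  define \<delta> where "\<delta> A = (\<Inter>m. W A m)" for A
  have \<delta>_Int: "\<delta> A \<inter> \<delta> B \<subseteq> \<delta> C"
    if "A \<in> events" "B \<in> events" "C \<in> events" "A \<inter> B \<subseteq> C" for A B C
  proof
    fix x assume x: "x \<in> \<delta> A \<inter> \<delta> B"
    have "x \<in> W C m" for m
    proof -
      from x have "x \<in> W A (Suc m)" "x \<in> W B (Suc m)" by (simp_all add: \<delta>_def)
      then obtain K L where "\<forall>n\<ge>K. x \<in> V A n (Suc m)" "\<forall>n\<ge>L. x \<in> V B n (Suc m)"
        unfolding W_iff by blast
      then have "x \<in> V C n m" if "max K L \<le> n" for n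
        using V_Int[OF \<open>A \<in> events\<close> \<open>B \<in> events\<close> \<open>C \<in> events\<close> \<open>A \<inter> B \<subseteq> C\<close>, of n m] that by auto
      then show ?thesis unfolding W_iff by blast
    qed
    then show "x \<in> \<delta> C" by (simp add: \<delta>_def)
  qed
  have \<delta>_null: "\<delta> A = {}" if "A \<in> events" "AE x in M. x \<notin> A" for A
    by (simp add: \<delta>_def W_def V_null[OF that])
  have \<delta>_self: "\<delta> A = A" if "A \<in> \<R> n" for A n
  proof -
    have "x \<in> W A m \<longleftrightarrow> x \<in> A" for x m
    proof
      assume "x \<in> W A m"
      then obtain K where "\<forall>k\<ge>K. x \<in> V A k m" unfolding W_iff by blast
      then have "x \<in> V A (max K n) m" by simp
      then show "x \<in> A" using V_self[OF that, of "max K n" m] by simp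
    next
      assume "x \<in> A"
      then have "\<forall>k\<ge>n. x \<in> V A k m" using V_self[OF that] by simp
      then show "x \<in> W A m" unfolding W_iff by blast
    qed
    then show ?thesis by (auto simp: \<delta>_def)
  qed
  have W_ae: "AE x in M. x \<in> A \<longrightarrow> x \<in> W A m" if A: "A \<in> N" for A m
  proof -
    note AM = N_events[OF A]
    \<comment> \<open>The bounds \<open>prob D\<close> and \<open>prob D / e (Suc m)\<close> for the
      two bad sets below add up to \<open>prob D * c\<close>.\<close>
    define c where "c = 1 + 1 / e (Suc m)"
    have c: "0 < c" using e(1)[of "Suc m"] by (simp add: c_def add_pos_pos)
    have "prob (A - W A m) \<le> 0 + \<eta>" if "0 < \<eta>" for \<eta>
    proof -
      have "0 < \<eta> / c" using that c by simp
      then obtain B where B: "B \<in> \<A>" "prob (sym_diff A B) < \<eta> / c"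
        by (rule approximableD[OF A[unfolded N_def]])
      \<comment> \<open>\<open>B\<close> is its own Hahn set from some index \<open>K\<close> on. At
        a point of \<open>A\<close> outside \<open>D\<close> and \<open>Z\<close>, both
        \<open>B\<close> and \<open>space M - D\<close> reach the threshold of level
        \<open>Suc m\<close> for all \<open>n \<ge> K\<close>, and their intersection lies in
        \<open>A\<close>; so \<open>A\<close> reaches that of level \<open>m\<close>.\<close>
      define D where "D = sym_diff A B"
      obtain K where K: "B \<in> \<R> K" using B(1) by (auto simp: \<A>_def)
      note BM = lifting_range_sets[OF R K]
      have DM: "D \<in> events" using AM BM by (auto simp: D_def)
      then have DM': "space M - D \<in> events" by auto
      \<comment> \<open>Here \<open>space M - D\<close> misses its threshold at some index; the
        maximal inequality makes this set small.\<close>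
      define Z where "Z = (\<Union>n. space M - V (space M - D) n (Suc m))"
      have ZM: "Z \<in> events" unfolding Z_def using V_events[OF DM'] by auto
      have "A - W A m \<subseteq> D \<union> Z"
      proof
        fix x assume x: "x \<in> A - W A m"
        show "x \<in> D \<union> Z"
        proof (rule ccontr)
          assume *: "x \<notin> D \<union> Z"
          have "x \<in> space M" using x sets.sets_into_space[OF AM] by blast
          then have "x \<in> V A n m" if n: "K \<le> n" for n
          proof -
            have "B \<inter> (space M - D) \<subseteq> A" by (auto simp: D_def)
            moreover have "x \<in> V B n (Suc m)" using x * V_self[OF K n] by (auto simp: D_def)
            moreover have "x \<in> V (space M - D) n (Suc m)"
              using * \<open>x \<in> space M\<close> by (auto simp: Z_def)
            ultimately show ?thesis using V_Int[OF BM DM' AM, of n m] by blast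
          qed
          then have "x \<in> W A m" unfolding W_iff by blast
          with x show False by simp
        qed
      qed
      then have "prob (A - W A m) \<le> prob (D \<union> Z)"
        using DM ZM by (intro finite_measure_mono) auto
      also have "\<dots> \<le> prob D + prob Z" using DM ZM by (rule measure_Un_le)
      also have "prob Z \<le> prob D / e (Suc m)"
      proof -
        have "e (Suc m) * prob Z \<le> prob (space M - (space M - D))"
          unfolding Z_def by (rule hahn_set_maximal_inequality[OF R inc DM' V[OF DM']])
        also have "space M - (space M - D) = D" using sets.sets_into_space[OF DM] by blast
        finally show ?thesis using e(1)[of "Suc m"] by (simp add: field_simps)
      qed
      also have "prob D + prob D / e (Suc m) = prob D * c" by (simp add: c_def algebra_simps)
      also have "\<dots> \<le> \<eta> / c * c" using B(2) c by (intro mult_right_mono) (auto simp: D_def)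
      finally show ?thesis using c by simp
    qed
    then have "prob (A - W A m) \<le> 0" by (rule field_le_epsilon)
    then have "prob (A - W A m) = 0" using measure_nonneg[of M "A - W A m"] by linarith
    then have "AE x in M. x \<notin> A - W A m" using prob_eq_0[of "A - W A m"] AM W_events[OF AM] by simp
    then show ?thesis by eventually_elim auto
  qed
  have \<delta>_ae: "AE x in M. x \<in> A \<longrightarrow> x \<in> \<delta> A" if A: "A \<in> N" for A
  proof -
    have "AE x in M. \<forall>m. x \<in> A \<longrightarrow> x \<in> W A m"
      using W_ae[OF A] by (simp only: AE_all_countable simp_thms)
    then show ?thesis by eventually_elim (simp add: \<delta>_def)
  qed
  \<comment> \<open>Null sets have empty \<open>\<delta>\<close>, so the events of \<open>N\<close>
    selected at \<open>x\<close> are a filter base of non-null sets.\<close>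
  have "\<exists>U. ae_ultrafilter M U \<and> {A \<in> N. x \<in> \<delta> A} \<subseteq> U" if x: "x \<in> space M" for x
  proof -
    let ?B = "{A \<in> N. x \<in> \<delta> A}"
    have sub: "?B \<subseteq> events" using N_events by auto
    have "space M \<in> ?B"
      using \<delta>_self[OF lifting_range_space[OF R]] RN[OF lifting_range_space[OF R]] x by simp
    then have ne: "?B \<noteq> {}" by blast
    have Int: "A \<inter> B \<in> ?B" if A: "A \<in> ?B" and B: "B \<in> ?B" for A B
    proof -
      have AB: "A \<in> N" "B \<in> N" "x \<in> \<delta> A \<inter> \<delta> B" using A B by simp_all
      with \<delta>_Int[OF N_events N_events N_events[OF N_Int] order_refl, of A B] N_Int[of A B]
      show ?thesis by blast
    qed
    have nonnull: "\<not> (AE x in M. x \<notin> A)" if A: "A \<in> ?B" for A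
    proof
      assume "AE x in M. x \<notin> A"
      with \<delta>_null[OF N_events, of A] A show False by simp
    qed
    obtain U where "ae_ultrafilter M U" "?B \<subseteq> U"
      by (rule ae_ultrafilter_exists[OF sub ne Int nonnull])
    then show ?thesis by blast
  qed
  then obtain U where U: "\<And>x. x \<in> space M \<Longrightarrow> ae_ultrafilter M (U x)"
    and sub_U: "\<And>x. x \<in> space M \<Longrightarrow> {A \<in> N. x \<in> \<delta> A} \<subseteq> U x"
    by metis
  have \<delta>_U: "A \<in> U x" if "x \<in> space M" "A \<in> N" "x \<in> \<delta> A" for x A
    using sub_U[OF that(1)] that(2,3) by blast
  define \<sigma> where "\<sigma> A = {x \<in> space M. A \<in> U x}" for A
  have \<sigma>_space: "\<sigma> (space M) = space M"
    using ae_ultrafilter_space[OF U] by (auto simp: \<sigma>_def)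
  have \<sigma>_Int: "\<sigma> (A \<inter> B) = \<sigma> A \<inter> \<sigma> B" if "A \<in> N" "B \<in> N" for A B
    using ae_ultrafilter_Int_iff[OF U N_events[OF that(1)] N_events[OF that(2)]] by (auto simp: \<sigma>_def)
  have \<sigma>_compl: "\<sigma> (space M - A) = space M - \<sigma> A" if "A \<in> N" for A
    using ae_ultrafilter_compl[OF U N_events[OF that]] by (auto simp: \<sigma>_def)
  \<comment> \<open>The a.e. inclusion of \<open>A\<close> in \<open>\<delta> A\<close>, applied to
    \<open>A\<close> and to its complement, gives both directions.\<close>
  have \<sigma>_ae: "AE x in M. x \<in> A \<longleftrightarrow> x \<in> \<sigma> A" if A: "A \<in> N" for A
    using \<delta>_ae[OF A] \<delta>_ae[OF N_compl[OF A]] AE_space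
  proof eventually_elim
    case (elim x)
    show ?case
    proof (cases "x \<in> A")
      case True
      then show ?thesis using elim A \<delta>_U by (simp add: \<sigma>_def)
    next
      case False
      then have "x \<in> \<sigma> (space M - A)" using elim N_compl[OF A] \<delta>_U by (simp add: \<sigma>_def)
      with False show ?thesis unfolding \<sigma>_compl[OF A] by simp
    qed
  qed
  have \<sigma>_events: "\<sigma> A \<in> events" if A: "A \<in> N" for A
    by (rule in_sets_AE[OF \<sigma>_ae[OF A] N_events[OF A]]) (auto simp: \<sigma>_def)
  have "lifting_range M (\<sigma> ` N)"
    unfolding lifting_range_def
  proof (intro conjI ballI allI impI)
    show "\<sigma> ` N \<subseteq> events" using \<sigma>_events by blast
    show "space M \<in> \<sigma> ` N"
      using imageI[OF RN[OF lifting_range_space[OF R]], of \<sigma>] by (simp add: \<sigma>_space)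
  next
    fix A B assume "A \<in> \<sigma> ` N" "B \<in> \<sigma> ` N"
    then obtain A' B' where *: "A' \<in> N" "B' \<in> N" "A = \<sigma> A'" "B = \<sigma> B'" by blast
    with imageI[OF N_Int[OF *(1,2)], of \<sigma>] show "A \<inter> B \<in> \<sigma> ` N" by (simp add: \<sigma>_Int)
  next
    fix A assume "A \<in> \<sigma> ` N"
    then obtain B where B: "B \<in> N" "A = \<sigma> B" by blast
    with imageI[OF N_compl[OF B(1)], of \<sigma>] show "space M - A \<in> \<sigma> ` N" by (simp add: \<sigma>_compl)
    \<comment> \<open>\<open>B\<close> is null together with \<open>A\<close>, and no ultrafilter
      contains a null set.\<close>
    assume "AE x in M. x \<notin> A"
    with \<sigma>_ae[OF B(1)] have "AE x in M. x \<notin> B" by eventually_elim (simp add: B)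
    then have "B \<notin> U x" if "x \<in> space M" for x using ae_ultrafilter_not_null[OF U[OF that]] by blast
    then show "A = {}" by (auto simp: B \<sigma>_def)
  next
    fix A :: "nat \<Rightarrow> 'a set" assume "range A \<subseteq> \<sigma> ` N"
    then have "\<exists>B. B \<in> N \<and> A n = \<sigma> B" for n by blast
    then obtain B where B: "\<And>n. B n \<in> N" "\<And>n. A n = \<sigma> (B n)" by metis
    have UN: "(\<Union>n. B n) \<in> N" unfolding N_def by (rule approximable_UN[OF \<A> B(1)[unfolded N_def]])
    have "AE x in M. \<forall>n. x \<in> B n \<longleftrightarrow> x \<in> A n"
      using \<sigma>_ae[OF B(1)] by (simp only: AE_all_countable B(2) simp_thms)
    with \<sigma>_ae[OF UN] have "AE x in M. x \<in> \<sigma> (\<Union>n. B n) \<longleftrightarrow> (\<exists>n. x \<in> A n)"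
      by eventually_elim auto
    with UN show "\<exists>B\<in>\<sigma> ` N. AE x in M. x \<in> B \<longleftrightarrow> (\<exists>n. x \<in> A n)" by blast
  qed
  \<comment> \<open>\<open>\<delta>\<close> fixes both \<open>A\<close> and its complement, so each
    point puts the one containing it into its ultrafilter, and \<open>\<sigma>\<close> fixes
    \<open>A\<close>.\<close>
  moreover have "\<R> n \<subseteq> \<sigma> ` N" for n
  proof
    fix A assume A: "A \<in> \<R> n"
    note AN = RN[OF A] and AS = lifting_range_into_space[OF R A]
    have A': "space M - A \<in> \<R> n" by (rule lifting_range_compl[OF R A])
    have "A \<subseteq> \<sigma> A" using \<delta>_self[OF A] \<delta>_U[OF _ AN] AS by (auto simp: \<sigma>_def)
    moreover have "space M - A \<subseteq> \<sigma> (space M - A)"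
      using \<delta>_self[OF A'] \<delta>_U[OF _ RN[OF A']] by (auto simp: \<sigma>_def)
    then have "\<sigma> A \<subseteq> A" unfolding \<sigma>_compl[OF AN] by (auto simp: \<sigma>_def)
    ultimately have "\<sigma> A = A" by blast
    with imageI[OF AN, of \<sigma>] show "A \<in> \<sigma> ` N" by simp
  qed
  ultimately show thesis by (rule that)
qed

section \<open>Upper bounds of chains and Zorn's lemma\<close>

lemma lifting_range_trivial: "lifting_range M {{}, space M}"
  unfolding lifting_range_def
proof (intro conjI ballI allI impI)
  fix A assume "A \<in> {{}, space M}" "AE x in M. x \<notin> A"
  then show "A = {}"
    using AE_False AE_space by (auto elim: eventually_elim2)
next
  fix A :: "nat \<Rightarrow> 'a set" assume A: "range A \<subseteq> {{}, space M}"
  have "(\<Union>n. A n) \<in> {{}, space M}" using A by blast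
  then show "\<exists>B\<in>{{}, space M}. AE x in M. x \<in> B \<longleftrightarrow> (\<exists>n. x \<in> A n)"
    by (intro bexI[of _ "\<Union>n. A n"]) auto
qed auto

text \<open>If every countable part of the union of \<open>C\<close> lies in one element of
  \<open>C\<close>, the union is a range, as each clause involves countably many sets at a time.
  Otherwise a countable \<open>D\<close> contained in no element yields a cofinal sequence, and
  \<open>lifting_range_seq_bound\<close> applies.\<close>

lemma lifting_range_chain_bound:
  assumes C: "subset.chain {\<R>. lifting_range M \<R>} C"
  obtains \<R>' where "lifting_range M \<R>'" "\<And>\<R>. \<R> \<in> C \<Longrightarrow> \<R> \<subseteq> \<R>'"
proof (cases "\<forall>D. countable D \<longrightarrow> D \<subseteq> \<Union>C \<longrightarrow> (\<exists>X\<in>C. D \<subseteq> X)")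
  case True
  have C_R: "lifting_range M X" if "X \<in> C" for X using C that by (auto simp: subset_chain_def)
  have ex: "\<exists>X\<in>C. D \<subseteq> X" if "countable D" "D \<subseteq> \<Union>C" for D using True that by blast
  show thesis
  \<comment> \<open>The union of the empty chain is empty and thus no range, so the trivial range
    takes its place.\<close>
  proof (cases "C = {}")
    case True
    with that lifting_range_trivial show thesis by blast
  next
    case False
    have "lifting_range M (\<Union>C)"
      unfolding lifting_range_def
    proof (intro conjI ballI allI impI)
      show "\<Union>C \<subseteq> events" using lifting_range_sets[OF C_R] by blast
      show "space M \<in> \<Union>C" using False lifting_range_space[OF C_R] by blast
    next
      fix A B assume "A \<in> \<Union>C" "B \<in> \<Union>C"
      with ex[of "{A, B}"] obtain X where "X \<in> C" "A \<in> X" "B \<in> X" by auto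
      with lifting_range_Int[OF C_R] show "A \<inter> B \<in> \<Union>C" by blast
    next
      fix A assume "A \<in> \<Union>C"
      then obtain X where X: "X \<in> C" "A \<in> X" by blast
      with lifting_range_compl[OF C_R] show "space M - A \<in> \<Union>C" by blast
      show "A = {}" if "AE x in M. x \<notin> A" by (rule lifting_range_null[OF C_R X(2) that]) fact
    next
      fix A :: "nat \<Rightarrow> 'a set" assume "range A \<subseteq> \<Union>C"
      with ex[of "range A"] obtain X where X: "X \<in> C" "range A \<subseteq> X" by auto
      from lifting_range_UN[OF C_R[OF X(1)] X(2)] X(1)
      show "\<exists>B\<in>\<Union>C. AE x in M. x \<in> B \<longleftrightarrow> (\<exists>n. x \<in> A n)" by blast
    qed
    then show thesis using that by blast
  qed
next
  case False
  then obtain D where D: "countable D" "D \<subseteq> \<Union>C" and not_sub: "\<And>X. X \<in> C \<Longrightarrow> \<not> D \<subseteq> X" by blast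
  have C_R: "lifting_range M X" if "X \<in> C" for X using C that by (auto simp: subset_chain_def)
  show thesis
  proof (cases "D = {}")
    case True
    then have "C = {}" using not_sub by blast
    with that lifting_range_trivial show thesis by blast
  next
    case D_ne: False
    define d where "d = from_nat_into D"
    have range_d: "range d = D" unfolding d_def by (rule range_from_nat_into[OF D_ne D(1)])
    then have "\<exists>X. X \<in> C \<and> d i \<in> X" for i using D(2) by blast
    then obtain X where X: "\<And>i. X i \<in> C" "\<And>i. d i \<in> X i" by metis
    \<comment> \<open>Partial unions make the sequence increasing and stay in \<open>C\<close>,
      since \<open>C\<close> is a chain.\<close>
    define Y where "Y n = (\<Union>i\<le>n. X i)" for n
    have "Y n \<in> C" for n
    proof (induction n)
      case (Suc n)
      have "Y n \<subseteq> X (Suc n) \<or> X (Suc n) \<subseteq> Y n"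
        using C Suc X(1) unfolding subset_chain_def by blast
      moreover have "Y (Suc n) = Y n \<union> X (Suc n)" by (simp add: Y_def atMost_Suc Un_commute)
      ultimately show ?case using Suc X(1) by (metis sup.absorb1 sup.absorb2)
    qed (simp add: Y_def X)
    moreover have "incseq Y" unfolding incseq_def Y_def by (intro allI impI UN_mono) auto
    ultimately obtain \<R>' where \<R>': "lifting_range M \<R>'" "\<And>n. Y n \<subseteq> \<R>'"
      using lifting_range_seq_bound[of Y] C_R by blast
    have "Z \<subseteq> \<R>'" if Z: "Z \<in> C" for Z
    proof -
      \<comment> \<open>Some \<open>d i\<close> is missing from \<open>Z\<close> but present in
        \<open>X i\<close>, so comparability leaves only \<open>Z \<subseteq> X i\<close>.\<close>
      obtain i where "d i \<notin> Z" using not_sub[OF Z] range_d by blast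
      moreover have "Z \<subseteq> X i \<or> X i \<subseteq> Z" using C Z X(1) unfolding subset_chain_def by blast
      ultimately have "Z \<subseteq> X i" using X(2) by blast
      also have "X i \<subseteq> Y i" by (auto simp: Y_def)
      also have "Y i \<subseteq> \<R>'" by (rule \<R>')
      finally show ?thesis .
    qed
    with \<R>'(1) show thesis by (rule that)
  qed
qed

text \<open>A maximal range contains a representative of every event, by the extension by one set.
  Passing to representatives is a lifting: the two sides of each law are a.e. equal members of \<R>,
  hence equal.\<close>

theorem lifting_exists: "liftings M \<noteq> {}"
proof -
  obtain \<R> where R: "lifting_range M \<R>"
    and max: "\<And>\<R>'. lifting_range M \<R>' \<Longrightarrow> \<R> \<subseteq> \<R>' \<Longrightarrow> \<R>' = \<R>"
    using subset_Zorn[of "{\<R>. lifting_range M \<R>}"] lifting_range_chain_bound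
    by (metis (no_types, lifting) mem_Collect_eq)
  have ex: "\<exists>B\<in>\<R>. AE x in M. x \<in> B \<longleftrightarrow> x \<in> A" if A: "A \<in> events" for A
    using lifting_range_extend[OF R A] max by metis
  define \<rho> where "\<rho> A = (SOME B. B \<in> \<R> \<and> (AE x in M. x \<in> B \<longleftrightarrow> x \<in> A))" for A
  have \<rho>: "\<rho> A \<in> \<R>" "AE x in M. x \<in> \<rho> A \<longleftrightarrow> x \<in> A" if "A \<in> events" for A
    using someI_ex[of "\<lambda>B. B \<in> \<R> \<and> (AE x in M. x \<in> B \<longleftrightarrow> x \<in> A)"] ex[OF that]
    unfolding \<rho>_def by blast+
  have \<rho>_eq: "\<rho> A = B" if "A \<in> events" "B \<in> \<R>" "AE x in M. x \<in> B \<longleftrightarrow> x \<in> A" for A B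
  proof (rule lifting_range_eq[OF R \<rho>(1)[OF that(1)] that(2)])
    show "AE x in M. x \<in> \<rho> A \<longleftrightarrow> x \<in> B"
      using \<rho>(2)[OF that(1)] that(3) by eventually_elim simp
  qed
  have "lower_density M \<rho>"
    unfolding lower_density_def
  proof (intro conjI ballI impI)
    fix A assume A: "A \<in> events"
    show "\<rho> A \<in> events" by (rule lifting_range_sets[OF R \<rho>(1)[OF A]])
    show "AE x in M. x \<in> \<rho> A \<longleftrightarrow> x \<in> A" by (rule \<rho>(2)[OF A])
    fix B assume B: "B \<in> events"
    show "\<rho> (A \<inter> B) = \<rho> A \<inter> \<rho> B"
    proof (rule \<rho>_eq)
      show "AE x in M. x \<in> \<rho> A \<inter> \<rho> B \<longleftrightarrow> x \<in> A \<inter> B"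
        using \<rho>(2)[OF A] \<rho>(2)[OF B] by eventually_elim simp
    qed (use A B \<rho>(1) lifting_range_Int[OF R] in auto)
    assume AB: "AE x in M. x \<in> A \<longleftrightarrow> x \<in> B"
    show "\<rho> A = \<rho> B"
    proof (rule \<rho>_eq[OF A \<rho>(1)[OF B]])
      show "AE x in M. x \<in> \<rho> B \<longleftrightarrow> x \<in> A"
        using \<rho>(2)[OF B] AB by eventually_elim simp
    qed
  next
    show "\<rho> {} = {}" by (rule \<rho>_eq) (simp_all add: lifting_range_empty[OF R])
    show "\<rho> (space M) = space M" by (rule \<rho>_eq) (simp_all add: lifting_range_space[OF R])
  qed
  moreover have "\<rho> (space M - A) = space M - \<rho> A" if A: "A \<in> events" for A
  proof (rule \<rho>_eq)
    show "AE x in M. x \<in> space M - \<rho> A \<longleftrightarrow> x \<in> space M - A"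
      using \<rho>(2)[OF A] by eventually_elim simp
  qed (use A \<rho>(1)[OF A] lifting_range_compl[OF R] in auto)
  ultimately show ?thesis unfolding liftings_def by blast
qed

end

section \<open>Liftings that fix a given function\<close>

text \<open>\<open>L f x = f x\<close> amounts to convergence of \<open>f\<close> to
  \<open>f x\<close> along the ultrafilter at \<open>x\<close>. An arbitrary lifting achieves this
  almost everywhere; at the other points \<open>ess\<close> supplies an ultrafilter that
  does.\<close>

lemma (in complete_prob_space) lifting_fixing_function:
  assumes f: "f \<in> borel_measurable M" and c: "AE x in M. \<bar>f x\<bar> \<le> c"
    and ess: "\<And>x e. x \<in> space M \<Longrightarrow> 0 < e \<Longrightarrow> \<not> (AE z in M. \<not> \<bar>f z - f x\<bar> < e)"
  obtains \<delta> L where "\<delta> \<in> liftings M" "induces_function_lifting M \<delta> L"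
    "\<And>x. x \<in> space M \<Longrightarrow> L f x = f x"
proof -
  obtain \<delta>0 where \<delta>0: "\<delta>0 \<in> liftings M" using lifting_exists by blast
  define U0 where "U0 x = {A \<in> sets M. x \<in> \<delta>0 A}" for x
  have U0: "ae_ultrafilter M (U0 x)" if "x \<in> space M" for x
    unfolding U0_def by (rule ultrafilter_of_lifting[OF \<delta>0 that])
  obtain L0 where L0: "induces_function_lifting M \<delta>0 L0"
    and L0_eq: "\<And>g x l. x \<in> space M \<Longrightarrow> (g \<longlongrightarrow> l) (filter_of {A \<in> sets M. x \<in> \<delta>0 A}) \<Longrightarrow> L0 g x = l"
    by (rule function_lifting_exists[OF \<delta>0]) (erule that, blast)
  have "\<exists>c. AE x in M. \<bar>f x\<bar> \<le> c" using c by (rule exI)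
  then have "f \<in> ess_bounded M"
    unfolding ess_bounded_def mem_Collect_eq using f by (simp only: Linf_norm_finite_iff simp_thms)
  then have "AE x in M. L0 f x = f x"
    using L0 unfolding induces_function_lifting_def function_lifting_def
    by (elim conjE) (drule (1) bspec, elim conjE, assumption)
  with AE_space have good: "AE x in M. (f \<longlongrightarrow> f x) (filter_of (U0 x))"
  proof eventually_elim
    case (elim x)
    obtain l where l: "(f \<longlongrightarrow> l) (filter_of (U0 x))"
      by (rule tendsto_filter_of[OF U0[OF elim(1)] f c])
    with L0_eq[OF elim(1) l[unfolded U0_def]] elim(2) show ?case by simp
  qed
  have "\<exists>U. ae_ultrafilter M U \<and> (f \<longlongrightarrow> f x) (filter_of U)" if x: "x \<in> space M" for x
  proof -
    \<comment> \<open>An ultrafilter containing every \<open>B e\<close> with \<open>e > 0\<close>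
      forces \<open>f\<close> to tend to \<open>f x\<close>; these sets are non-null by
      \<open>ess\<close>.\<close>
    define B where "B e = {z \<in> space M. \<bar>f z - f x\<bar> < e}" for e
    have sub: "B ` {0<..} \<subseteq> sets M" using f by (auto simp: B_def)
    have ne: "B ` {0<..} \<noteq> {}" by auto
    have Int: "C \<inter> D \<in> B ` {0<..}" if CD: "C \<in> B ` {0<..}" "D \<in> B ` {0<..}" for C D
    proof -
      from CD obtain d e where "0 < d" "0 < e" "C = B d" "D = B e" by auto
      moreover have "B d \<inter> B e = B (min d e)" for d e by (auto simp: B_def)
      ultimately show ?thesis by auto
    qed
    have nonnull: "\<not> (AE z in M. z \<notin> C)" if C: "C \<in> B ` {0<..}" for C
    proof
      assume "AE z in M. z \<notin> C"
      moreover from C obtain e where e: "0 < e" "C = B e" by auto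
      ultimately have "AE z in M. z \<notin> B e" by simp
      with AE_space have "AE z in M. \<not> \<bar>f z - f x\<bar> < e" by eventually_elim (simp add: B_def)
      with ess[OF x e(1)] show False by simp
    qed
    obtain U where U: "ae_ultrafilter M U" "B ` {0<..} \<subseteq> U"
      by (rule ae_ultrafilter_exists[OF sub ne Int nonnull])
    have "(f \<longlongrightarrow> f x) (filter_of U)"
    proof (rule tendstoI)
      fix e :: real assume "0 < e"
      with U(2) have "B e \<in> U" by auto
      moreover have "\<forall>z\<in>B e. dist (f z) (f x) < e" by (simp add: B_def dist_real_def)
      ultimately show "eventually (\<lambda>z. dist (f z) (f x) < e) (filter_of U)"
        unfolding eventually_filter_of[OF U(1)] by blast
    qed
    with U(1) show ?thesis by blast
  qed
  then obtain U1 where U1: "\<And>x. x \<in> space M \<Longrightarrow> ae_ultrafilter M (U1 x)"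
    "\<And>x. x \<in> space M \<Longrightarrow> (f \<longlongrightarrow> f x) (filter_of (U1 x))" by metis
  \<comment> \<open>The original ultrafilter is kept wherever it works, so \<open>U\<close> departs
    from \<open>U0\<close> only on a null set and the a.e. condition survives.\<close>
  define U where "U x = (if (f \<longlongrightarrow> f x) (filter_of (U0 x)) then U0 x else U1 x)" for x
  have U: "ae_ultrafilter M (U x)" "(f \<longlongrightarrow> f x) (filter_of (U x))" if "x \<in> space M" for x
    using U0[OF that] U1[OF that] by (simp_all add: U_def)
  define \<delta> where "\<delta> A = {x \<in> space M. A \<in> U x}" for A
  have "\<delta> \<in> liftings M"
    unfolding \<delta>_def
  proof (rule lifting_of_ultrafilters[OF U(1)])
    fix A assume A: "A \<in> sets M"
    have "AE x in M. x \<in> \<delta>0 A \<longleftrightarrow> x \<in> A"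
      using \<delta>0 A unfolding liftings_def lower_density_def by blast
    with good show "AE x in M. A \<in> U x \<longleftrightarrow> x \<in> A"
      by eventually_elim (simp add: U_def U0_def A)
  qed
  moreover obtain L where L: "induces_function_lifting M \<delta> L"
    and L_eq: "\<And>g x l. x \<in> space M \<Longrightarrow> (g \<longlongrightarrow> l) (filter_of {A \<in> sets M. x \<in> \<delta> A}) \<Longrightarrow> L g x = l"
    by (rule function_lifting_exists[OF \<open>\<delta> \<in> liftings M\<close>]) (erule that, blast)
  moreover have "L f x = f x" if x: "x \<in> space M" for x
  proof (rule L_eq[OF x])
    have "{A \<in> sets M. x \<in> \<delta> A} = U x"
      using x ae_ultrafilter_sets[OF U(1)[OF x]] by (auto simp: \<delta>_def)
    with U(2)[OF x] show "(f \<longlongrightarrow> f x) (filter_of {A \<in> sets M. x \<in> \<delta> A})" by simp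
  qed
  ultimately show thesis by (intro that)
qed

section \<open>Product regular conditional probabilities\<close>

lemma product_rcp_measurable_section:
  assumes rcp: "product_rcp P Q R S" and E: "E \<in> sets (P \<Otimes>\<^sub>M Q)"
  shows "(\<lambda>y. emeasure (S y) ((\<lambda>x. (x, y)) -` E)) \<in> borel_measurable Q"
proof (rule emeasure_measurable_subprob_algebra2)
  show "S \<in> measurable Q (subprob_algebra P)"
    using rcp by (intro measurable_subprob_algebra)
      (auto simp: product_rcp_def intro: prob_space_imp_subprob_space)
  \<comment> \<open>The parameter \<open>y\<close> has to be the first coordinate here, hence the
    swap of the factors.\<close>
  have "(SIGMA y:space Q. (\<lambda>x. (x, y)) -` E) = (\<lambda>(y, x). (x, y)) -` E \<inter> space (Q \<Otimes>\<^sub>M P)"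
    using sets.sets_into_space[OF E] by (auto simp: space_pair_measure)
  also have "\<dots> \<in> sets (Q \<Otimes>\<^sub>M P)"
    using measurable_pair_swap' E by (rule measurable_sets)
  finally show "(SIGMA y:space Q. (\<lambda>x. (x, y)) -` E) \<in> sets (Q \<Otimes>\<^sub>M P)" .
qed

text \<open>Rectangles are covered by the definition of \<open>product_rcp\<close>. They are stable
  under intersection and generate the product sigma-algebra, so the formula spreads through
  complements and disjoint unions.\<close>

lemma product_rcp_emeasure:
  assumes Q: "prob_space Q" and R: "prob_space R" and sets_R: "sets R = sets (P \<Otimes>\<^sub>M Q)"
    and rcp: "product_rcp P Q R S" and E: "E \<in> sets (P \<Otimes>\<^sub>M Q)"
  shows "emeasure R E = (\<integral>\<^sup>+y. emeasure (S y) ((\<lambda>x. (x, y)) -` E) \<partial>Q)"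
proof -
  interpret Q: prob_space Q by fact
  interpret R: prob_space R by fact
  have Sp: "prob_space (S y)" and Ss: "sets (S y) = sets P" if "y \<in> space Q" for y
    using rcp that by (auto simp: product_rcp_def)
  have Ssp: "space (S y) = space P" if "y \<in> space Q" for y
    by (rule sets_eq_imp_space_eq[OF Ss[OF that]])
  have space_R: "space R = space P \<times> space Q"
    using sets_eq_imp_space_eq[OF sets_R] by (simp add: space_pair_measure)
  let ?sec = "\<lambda>E y. (\<lambda>x. (x, y)) -` E"
  have sec: "?sec E y \<in> sets (S y)" if "E \<in> sets (P \<Otimes>\<^sub>M Q)" "y \<in> space Q" for E y
    using sets_Pair2[OF that(1), of y] Ss[OF that(2)] by simp
  note meas = product_rcp_measurable_section[OF rcp]
  show ?thesis
    using Int_stable_pair_measure_generator[of P Q] pair_measure_closed[of P Q] E[unfolded sets_pair_measure]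
  proof (induction E rule: sigma_sets_induct_disjoint)
    case (basic E)
    then obtain A B where AB: "E = A \<times> B" "A \<in> sets P" "B \<in> sets Q" by auto
    have "?sec E y = (if y \<in> B then A else {})" for y by (auto simp: AB)
    moreover have "emeasure R E = (\<integral>\<^sup>+y\<in>B. emeasure (S y) A \<partial>Q)"
      using rcp AB by (simp add: product_rcp_def)
    ultimately show ?case by (auto intro!: nn_integral_cong simp: indicator_def)
  next
    case empty
    then show ?case by simp
  next
    case (compl E)
    have E: "E \<in> sets (P \<Otimes>\<^sub>M Q)" using compl(1) by (simp add: sets_pair_measure)
    have *: "emeasure (S y) (?sec (space P \<times> space Q - E) y) = 1 - emeasure (S y) (?sec E y)"
      if y: "y \<in> space Q" for y
    proof -
      interpret Sy: prob_space "S y" by (rule Sp[OF y])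
      have "?sec (space P \<times> space Q - E) y = space (S y) - ?sec E y"
        using y Ssp[OF y] by auto
      then show ?thesis
        using sec[OF E y] by (simp add: emeasure_compl Sy.emeasure_space_1)
    qed
    have le1: "emeasure (S y) (?sec E y) \<le> 1" if "y \<in> space Q" for y
      by (rule prob_space.emeasure_le_1[OF Sp[OF that]])
    have fin: "(\<integral>\<^sup>+y. emeasure (S y) (?sec E y) \<partial>Q) \<noteq> \<infinity>"
      using compl.IH R.emeasure_finite[of E] by simp
    have "emeasure R (space P \<times> space Q - E) = 1 - emeasure R E"
      using emeasure_compl[of E R] E sets_R R.emeasure_space_1 by (simp add: space_R)
    also have "\<dots> = (\<integral>\<^sup>+y. 1 \<partial>Q) - (\<integral>\<^sup>+y. emeasure (S y) (?sec E y) \<partial>Q)"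
      by (simp add: compl.IH Q.emeasure_space_1)
    also have "\<dots> = (\<integral>\<^sup>+y. 1 - emeasure (S y) (?sec E y) \<partial>Q)"
      by (rule nn_integral_diff[symmetric]) (use meas[OF E] fin le1 in auto)
    also have "\<dots> = (\<integral>\<^sup>+y. emeasure (S y) (?sec (space P \<times> space Q - E) y) \<partial>Q)"
      by (rule nn_integral_cong) (simp add: *)
    finally show ?case .
  next
    case (union A)
    have A: "A i \<in> sets (P \<Otimes>\<^sub>M Q)" for i using union(2) by (auto simp: sets_pair_measure)
    have *: "emeasure (S y) (?sec (\<Union>i. A i) y) = (\<Sum>i. emeasure (S y) (?sec (A i) y))"
      if y: "y \<in> space Q" for y
    proof -
      have "disjoint_family (\<lambda>i. ?sec (A i) y)"
        using union(1) by (auto simp: disjoint_family_on_def)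
      then have "(\<Sum>i. emeasure (S y) (?sec (A i) y)) = emeasure (S y) (\<Union>i. ?sec (A i) y)"
        using sec[OF A y] by (intro suminf_emeasure) auto
      then show ?thesis by (simp add: vimage_UN)
    qed
    have "emeasure R (\<Union>i. A i) = (\<Sum>i. emeasure R (A i))"
      using A sets_R union(1) by (intro suminf_emeasure[symmetric]) auto
    also have "\<dots> = (\<integral>\<^sup>+y. (\<Sum>i. emeasure (S y) (?sec (A i) y)) \<partial>Q)"
      using meas[OF A] by (simp add: union.IH nn_integral_suminf)
    also have "\<dots> = (\<integral>\<^sup>+y. emeasure (S y) (?sec (\<Union>i. A i) y) \<partial>Q)"
      by (rule nn_integral_cong) (simp add: *)
    finally show ?case .
  qed
qed

text \<open>\<open>D\<close> is measurable only for the completion, so disintegration is applied to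
  a measurable \<open>E\<close> inside it, with \<open>D - E\<close> contained in a null set. A null
  section of \<open>D\<close> makes the section of \<open>E\<close> null.\<close>

lemma product_rcp_section_null:
  assumes Q: "prob_space Q" and R: "prob_space R" and sets_R: "sets R = sets (P \<Otimes>\<^sub>M Q)"
    and rcp: "product_rcp P Q R S" and D: "D \<in> sets (completion R)"
    and secs: "\<And>y. y \<in> space Q \<Longrightarrow> (\<lambda>x. (x, y)) -` D \<in> sets P"
  shows "{(x, y). (x, y) \<in> D \<and> emeasure (S y) ((\<lambda>x. (x, y)) -` D) = 0} \<in> null_sets (completion R)"
    (is "?Z \<in> _")
proof -
  let ?sec = "\<lambda>E y. (\<lambda>x. (x, y)) -` E"
  have Ss: "sets (S y) = sets P" if "y \<in> space Q" for y
    using rcp that by (simp add: product_rcp_def)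
  have space_R: "space R = space P \<times> space Q"
    using sets_eq_imp_space_eq[OF sets_R] by (simp add: space_pair_measure)
  from D obtain E N N' where D_eq: "D = E \<union> N" and N: "N \<subseteq> N'" "N' \<in> null_sets R" and E: "E \<in> sets R"
    by (rule sets_completionE)
  have EP: "E \<in> sets (P \<Otimes>\<^sub>M Q)" using E sets_R by simp
  note meas = product_rcp_measurable_section[OF rcp EP]
  define Y where "Y = {y \<in> space Q. emeasure (S y) (?sec E y) = 0}"
  \<comment> \<open>The part of \<open>E\<close> lying over the \<open>y\<close> with null section;
    integrating its sections shows that it is \<open>R\<close>-null.\<close>
  define E0 where "E0 = E \<inter> (space P \<times> Y)"
  have "Y \<in> sets Q" unfolding Y_def using meas by measurable
  then have E0: "E0 \<in> sets (P \<Otimes>\<^sub>M Q)" using EP by (auto simp: E0_def)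
  have "emeasure (S y) (?sec E0 y) = 0" if y: "y \<in> space Q" for y
  proof -
    have "?sec E0 y = (if y \<in> Y then ?sec E y else {})"
      using sets.sets_into_space[OF EP] by (auto simp: E0_def space_pair_measure)
    then show ?thesis by (simp add: Y_def)
  qed
  then have "(\<integral>\<^sup>+y. emeasure (S y) (?sec E0 y) \<partial>Q) = (\<integral>\<^sup>+y. 0 \<partial>Q)"
    by (intro nn_integral_cong)
  then have "emeasure R E0 = 0"
    unfolding product_rcp_emeasure[OF Q R sets_R rcp E0] by simp
  then have "E0 \<in> null_sets R" using E0 sets_R by (simp add: null_sets_def)
  then have null: "E0 \<union> N' \<in> null_sets R" using N(2) by (rule null_sets.Un)
  have "?Z \<subseteq> E0 \<union> N'"
  proof
    fix p assume "p \<in> ?Z"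
    then obtain x y where p: "p = (x, y)" and xy: "(x, y) \<in> D" "emeasure (S y) (?sec D y) = 0" by auto
    have "(x, y) \<in> space R" using xy(1) sets.sets_into_space[OF D] by auto
    then have y: "x \<in> space P" "y \<in> space Q" by (simp_all add: space_R)
    \<comment> \<open>\<open>emeasure\<close> is 0 by default on non-measurable sets;
      \<open>secs\<close> makes the zero for \<open>D\<close> a true one, which passes to the
      subset.\<close>
    have secD: "?sec D y \<in> sets (S y)" using secs[OF y(2)] Ss[OF y(2)] by simp
    have "?sec E y \<subseteq> ?sec D y" unfolding D_eq by blast
    then have "emeasure (S y) (?sec E y) = 0" by (rule emeasure_eq_0[OF secD xy(2)])
    then have "y \<in> Y" using y(2) by (simp add: Y_def)
    with xy(1) y(1) N(1) show "p \<in> E0 \<union> N'" unfolding p E0_def D_eq by blast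
  qed
  with null show ?thesis by (rule null_sets_completion_subset[rotated, OF null_sets_completionI])
qed

section \<open>Modification of the process and choice of the liftings\<close>

theorem theorem5p1:
  fixes P :: "'a measure" and Q :: "'b measure" and R :: "('a \<times> 'b) measure"
    and S :: "'b \<Rightarrow> 'a measure" and \<xi> :: "'b \<Rightarrow> 'a \<Rightarrow> real"
  assumes "prob_space P" and "prob_space Q"
    and "liftings Q \<noteq> {}"
    and "prob_space R" and "sets R = sets (P \<Otimes>\<^sub>M Q)"
    and "distr R P fst = P" and "distr R Q snd = Q"
    and "product_rcp P Q R S"
    and "\<exists>G. countable G \<and> algebra (space P) G \<and> dense_family P G"
    and "real_process P (space Q) \<xi>"
    and "jointly_measurable (completion R) \<xi>"
    and "bounded_process S (space Q) \<xi>"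
  shows "\<exists>(\<zeta> :: 'b \<Rightarrow> 'a \<Rightarrow> real) (\<sigma> :: 'b \<Rightarrow> 'a set \<Rightarrow> 'a set)
            (L :: 'b \<Rightarrow> ('a \<Rightarrow> real) \<Rightarrow> ('a \<Rightarrow> real)).
     (\<forall>y\<in>space Q. \<zeta> y \<in> borel_measurable (completion (S y))) \<and>
     (\<forall>y\<in>space Q. \<sigma> y \<in> liftings (completion (S y)) \<and>
        induces_function_lifting (completion (S y)) (\<sigma> y) (L y)) \<and>
     (\<forall>y\<in>space Q. AE x in S y. \<xi> y x = \<zeta> y x) \<and>
     (\<forall>y\<in>space Q. \<forall>x\<in>space P. \<zeta> y x = L y (\<zeta> y) x) \<and>
     jointly_measurable (completion R) \<zeta>"
proof -
  have Sp: "prob_space (S y)" and Ss: "sets (S y) = sets P" if "y \<in> space Q" for y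
    using \<open>product_rcp P Q R S\<close> that by (auto simp: product_rcp_def)
  have Ssp: "space (S y) = space P" if "y \<in> space Q" for y
    by (rule sets_eq_imp_space_eq[OF Ss[OF that]])
  have space_R: "space R = space P \<times> space Q"
    using sets_eq_imp_space_eq[OF \<open>sets R = _\<close>] by (simp add: space_pair_measure)
  have \<xi>P: "\<xi> y \<in> borel_measurable P" if "y \<in> space Q" for y
    using \<open>real_process P (space Q) \<xi>\<close> that by (simp add: real_process_def)
  have \<xi>S: "\<xi> y \<in> borel_measurable (S y)" if "y \<in> space Q" for y
    using \<xi>P[OF that] measurable_cong_sets[OF Ss[OF that] refl] by blast
  have \<xi>R: "(\<lambda>(x, y). \<xi> y x) \<in> borel_measurable (completion R)"
    using assms(11) by (simp add: jointly_measurable_def)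
  define I where "I r s y = {x \<in> space P. of_rat r < \<xi> y x \<and> \<xi> y x < of_rat s}" for r s :: rat and y
  have I_P: "I r s y \<in> sets P" if "y \<in> space Q" for r s y
    unfolding I_def using \<xi>P[OF that] by measurable
  \<comment> \<open>These are the points where \<open>\<xi> y\<close> takes a value outside its
    essential range under \<open>S y\<close>: some rational interval around the value has a null
    preimage. Countability of the rationals keeps the union null.\<close>
  define N where "N y = (\<Union>(r, s)\<in>{(r, s). emeasure (S y) (I r s y) = 0}. I r s y)" for y
  have N_null: "N y \<in> null_sets (S y)" if y: "y \<in> space Q" for y
    unfolding N_def using I_P[OF y] Ss[OF y] by (intro null_sets_UN') (auto simp: null_sets_def)
  have ex_c: "\<exists>x. x \<in> space P \<and> x \<notin> N y" if y: "y \<in> space Q" for y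
  proof (rule ccontr)
    interpret Sy: prob_space "S y" by (rule Sp[OF y])
    assume "\<nexists>x. x \<in> space P \<and> x \<notin> N y"
    then have "AE x in S y. x \<in> N y" using Ssp[OF y] by (intro AE_I2) auto
    with AE_not_in[OF N_null[OF y]] have "AE x in S y. False" by eventually_elim simp
    then show False by simp
  qed
  \<comment> \<open>The choice of \<open>p y\<close> is not controlled in \<open>y\<close>; joint
    measurability survives because the altered points form a null set of the completion of
    \<open>R\<close>.\<close>
  then obtain p where p: "\<And>y. y \<in> space Q \<Longrightarrow> p y \<in> space P" "\<And>y. y \<in> space Q \<Longrightarrow> p y \<notin> N y" by metis
  define \<zeta> where "\<zeta> y x = (if x \<in> N y then \<xi> y (p y) else \<xi> y x)" for y x
  have \<zeta>_ae: "AE x in S y. \<xi> y x = \<zeta> y x" if y: "y \<in> space Q" for y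
    using AE_not_in[OF N_null[OF y]] by eventually_elim (simp add: \<zeta>_def)
  have \<zeta>_meas: "\<zeta> y \<in> borel_measurable (completion (S y))" if y: "y \<in> space Q" for y
    by (rule completion.borel_measurable_AE[OF measurable_completion[OF \<xi>S[OF y]] AE_completion[OF \<zeta>_ae[OF y]]])
  have "\<exists>\<delta> L. \<delta> \<in> liftings (completion (S y)) \<and> induces_function_lifting (completion (S y)) \<delta> L \<and>
      (\<forall>x\<in>space P. L (\<zeta> y) x = \<zeta> y x)" if y: "y \<in> space Q" for y
  proof -
    interpret Sy: prob_space "S y" by (rule Sp[OF y])
    interpret C: complete_prob_space "completion (S y)"
      by (intro complete_prob_space.intro Sy.prob_space_completion completion.complete_measure_axioms)
    have "Linf_norm (S y) (\<xi> y) < \<infinity>"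
      using assms(12) SUP_upper[OF y, of "\<lambda>y. Linf_norm (S y) (\<xi> y)"]
      unfolding bounded_process_def by (rule le_less_trans[rotated])
    then obtain c where c: "AE x in S y. \<bar>\<xi> y x\<bar> \<le> c"
      unfolding Linf_norm_finite_iff[OF \<xi>S[OF y]] ..
    have c': "AE x in completion (S y). \<bar>\<zeta> y x\<bar> \<le> c"
      using AE_completion[OF c] AE_completion[OF \<zeta>_ae[OF y]] by eventually_elim simp
    have ess: "\<not> (AE z in completion (S y). \<not> \<bar>\<zeta> y z - \<zeta> y x\<bar> < e)"
      if x: "x \<in> space (completion (S y))" and e: "0 < e" for x e
    proof
      assume "AE z in completion (S y). \<not> \<bar>\<zeta> y z - \<zeta> y x\<bar> < e"
      then have far: "AE z in S y. \<not> \<bar>\<zeta> y z - \<zeta> y x\<bar> < e" by (simp only: AE_completion_iff)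
      \<comment> \<open>Every value of \<open>\<zeta> y\<close> is the value of
        \<open>\<xi> y\<close> at a point outside \<open>N y\<close>, and so lies in the essential
        range.\<close>
      define x' where "x' = (if x \<in> N y then p y else x)"
      have x': "x' \<in> space P" "x' \<notin> N y" "\<zeta> y x = \<xi> y x'"
        using p[OF y] x Ssp[OF y] by (auto simp: x'_def \<zeta>_def)
      \<comment> \<open>A rational interval around \<open>\<xi> y x'\<close> within distance
        \<open>e\<close>; if its preimage were null, \<open>x'\<close> would belong to
        \<open>N y\<close>.\<close>
      obtain r where r: "\<xi> y x' - e < of_rat r" "of_rat r < \<xi> y x'"
        using of_rat_dense[of "\<xi> y x' - e" "\<xi> y x'"] e by auto
      obtain s where s: "\<xi> y x' < of_rat s" "of_rat s < \<xi> y x' + e"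
        using of_rat_dense[of "\<xi> y x'" "\<xi> y x' + e"] e by auto
      have "AE z in S y. z \<notin> I r s y"
        using far \<zeta>_ae[OF y]
      proof eventually_elim
        case (elim z)
        show ?case
        proof
          assume "z \<in> I r s y"
          then have "\<bar>\<xi> y z - \<xi> y x'\<bar> < e" using r s by (auto simp: I_def)
          with elim x'(3) show False by simp
        qed
      qed
      then have "emeasure (S y) (I r s y) = 0"
        using I_P[OF y] Ss[OF y] AE_iff_null_sets[of "I r s y" "S y"] by auto
      moreover have "x' \<in> I r s y" using r s x'(1) by (simp add: I_def)
      ultimately have "x' \<in> N y" by (auto simp: N_def)
      with x'(2) show False ..
    qed
    obtain \<delta> L where "\<delta> \<in> liftings (completion (S y))" "induces_function_lifting (completion (S y)) \<delta> L"
      "\<And>x. x \<in> space (completion (S y)) \<Longrightarrow> L (\<zeta> y) x = \<zeta> y x"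
      by (rule C.lifting_fixing_function[OF \<zeta>_meas[OF y] c' ess]) (assumption+, erule (1) that, blast)
    then show ?thesis using Ssp[OF y] by auto
  qed
  then obtain \<sigma> L where \<sigma>L: "\<And>y. y \<in> space Q \<Longrightarrow> \<sigma> y \<in> liftings (completion (S y)) \<and>
      induces_function_lifting (completion (S y)) (\<sigma> y) (L y) \<and> (\<forall>x\<in>space P. L y (\<zeta> y) x = \<zeta> y x)"
    by metis
  have "jointly_measurable (completion R) \<zeta>"
    unfolding jointly_measurable_def
  proof (rule completion.borel_measurable_AE[OF \<xi>R])
    \<comment> \<open>\<open>D r s\<close> has the sets \<open>I r s y\<close> as sections and is
      the preimage of a rational interval under the joint map, hence measurable for the
      completion.\<close>
    define D where "D r s = {(x, y). (x, y) \<in> space R \<and> x \<in> I r s y}" for r s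
    have sec: "(\<lambda>x. (x, y)) -` D r s = I r s y" if "y \<in> space Q" for r s y
      using that by (auto simp: D_def I_def space_R)
    have "D r s = (\<lambda>(x, y). \<xi> y x) -` {of_rat r<..<of_rat s} \<inter> space (completion R)" for r s
      by (auto simp: D_def I_def space_R)
    then have "D r s \<in> sets (completion R)" for r s
      using measurable_sets[OF \<xi>R, of "{of_rat r<..<of_rat s}"] by simp
    then have "{(x, y). (x, y) \<in> D r s \<and> emeasure (S y) ((\<lambda>x. (x, y)) -` D r s) = 0}
        \<in> null_sets (completion R)" for r s
      by (rule product_rcp_section_null[OF assms(2,4,5,8)]) (simp add: sec I_P)
    then have "AE z in completion R. z \<notin> {(x, y). (x, y) \<in> D r s \<and> emeasure (S y) ((\<lambda>x. (x, y)) -` D r s) = 0}" for r s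
      by (rule AE_not_in)
    then have "AE z in completion R. \<forall>r s. z \<notin> {(x, y). (x, y) \<in> D r s \<and> emeasure (S y) ((\<lambda>x. (x, y)) -` D r s) = 0}"
      by (simp only: AE_all_countable simp_thms)
    \<comment> \<open>Where the two maps differ, \<open>x \<in> N y\<close>, so the point lies in
      one of countably many null sets.\<close>
    with AE_space show "AE z in completion R. (case z of (x, y) \<Rightarrow> \<xi> y x) = (case z of (x, y) \<Rightarrow> \<zeta> y x)"
    proof eventually_elim
      case (elim z)
      obtain x y where z: "z = (x, y)" by (cases z)
      with elim(1) have xy: "x \<in> space P" "y \<in> space Q" by (simp_all add: space_R)
      have "x \<notin> N y"
      proof
        assume "x \<in> N y"
        then obtain r s where "emeasure (S y) (I r s y) = 0" "x \<in> I r s y" by (auto simp: N_def)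
        then have "(x, y) \<in> D r s \<and> emeasure (S y) ((\<lambda>x. (x, y)) -` D r s) = 0"
          using xy sec[OF xy(2)] by (simp add: D_def space_R)
        with elim(2) show False by (auto simp: z)
      qed
      then show ?case by (simp add: z \<zeta>_def)
    qed
  qed
  then show ?thesis
    using \<sigma>L \<zeta>_meas \<zeta>_ae by (intro exI[of _ \<zeta>] exI[of _ \<sigma>] exI[of _ L]) simp
qed

end
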